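(* Let $a,b,c,\mu\in\mathbb{C}$ with $\operatorname{Re}\mu>0$. Each of the following identities holds for the indicated $x$ under the indicated additional conditions, provided the lower (third) parameters of the hypergeometric functions occurring in the two functions $w_j$ in that identity are not in $\mathbb{Z}_{\le0}$. (1) For $x\in(-\infty,0)\cup(0,1)$, $\operatorname{Re}c>0$: $$\int_{0<y/x<1}|y|^{c-1}w_1(y;a,b,c)\tfrac{|x-y|^{\mu-1}}{\Gamma(\mu)}dy=\tfrac{\Gamma(c)}{\Gamma(c+\mu)}|x|^{c+\mu-1}w_1(x;a,b,c+\mu).$$ (2) For $x\in(-\infty,0)\cup(0,1)$, $\operatorname{Re}(a-c+1)>\operatorname{Re}\mu$, $\operatorname{Re}(b-c+1)>\operatorname{Re}\mu$: $$\int_{-\infty}^x|y|^{c-1}w_2(y;a,b,c)\tfrac{(x-y)^{\mu-1}}{\Gamma(\mu)}dy=\tfrac{\Gamma(a-c-\mu+1)}{\Gamma(a-c+1)}\tfrac{\Gamma(b-c-\mu+1)}{\Gamma(b-c+1)}\tfrac{\Gamma(2-c)}{\Gamma(2-c-\mu)}|x|^{c+\mu-1}w_2(x;a,b,c+\mu).$$ (3) For $x\in(-\infty,0)\cup(1,\infty)$, $\operatorname{Re}(a-c+1)>\operatorname{Re}\mu$: $$\int_{y/x>1}|y|^{c-1}w_3(y;a,b,c)\tfrac{|x-y|^{\mu-1}}{\Gamma(\mu)}dy=\tfrac{\Gamma(a-c-\mu+1)}{\Gamma(a-c+1)}|x|^{c+\mu-1}w_3(x;a,b,c+\mu).$$ (4)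 For $x\in(-\infty,0)\cup(1,\infty)$, $\operatorname{Re}(b-c+1)>\operatorname{Re}\mu$: $$\int_{y/x>1}|y|^{c-1}w_4(y;a,b,c)\tfrac{|x-y|^{\mu-1}}{\Gamma(\mu)}dy=\tfrac{\Gamma(b-c-\mu+1)}{\Gamma(b-c+1)}|x|^{c+\mu-1}w_4(x;a,b,c+\mu).$$ (5) For $x\in(0,\infty)$, $\operatorname{Re}(a-c+1)>\operatorname{Re}\mu$, $\operatorname{Re}(b-c+1)>\operatorname{Re}\mu$: $$\int_x^\infty y^{c-1}w_5(y;a,b,c)\tfrac{(y-x)^{\mu-1}}{\Gamma(\mu)}dy=\tfrac{\Gamma(b-c-\mu+1)}{\Gamma(b-c+1)}\tfrac{\Gamma(a-c-\mu+1)}{\Gamma(a-c+1)}\tfrac{\Gamma(a+b-c+1)}{\Gamma(a+b-c-\mu+1)}x^{c+\mu-1}w_5(x;a,b,c+\mu).$$ (6) For $x\in(0,1)\cup(1,\infty)$, $\operatorname{Re}(c-a-b+1)>0$: $$\int_{0<\frac{1-y}{1-x}<1}y^{c-1}w_6(y;a,b,c)\tfrac{|y-x|^{\mu-1}}{\Gamma(\mu)}dy=\tfrac{\Gamma(c-a-b+1)}{\Gamma(c-a-b+\mu+1)}x^{c+\mu-1}w_6(x;a,b,c+\mu).$$ (7) For $x\in(-\infty,0)\cup(0,1)$, $\operatorname{Re}(a-c+1)>\operatorname{Re}\mu$: $$\int_{0<y/x<1}|y|^{a-\mu-1}w_2(y;a,b,c)\tfrac{|x-y|^{\mu-1}}{\Gamma(\mu)}dy=\tfrac{\Gamma(a-c-\mu+1)}{\Gamma(a-c+1)}|x|^{a-1}w_2(x;a-\mu,b,c).$$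 (8) For $x\in(-\infty,0)\cup(1,\infty)$, $\operatorname{Re}b>\operatorname{Re}\mu$: $$\int_{y/x>1}w_4(y;a,b,c)\tfrac{|x-y|^{\mu-1}}{\Gamma(\mu)}dy=\tfrac{\Gamma(b-\mu)}{\Gamma(b)}w_4(x;a-\mu,b-\mu,c-\mu).$$ (9) For $x\in(0,1)\cup(1,\infty)$, $\operatorname{Re}(c-a-b+1)>0$: $$\int_{0<\frac{1-y}{1-x}<1}w_6(y;a,b,c)\tfrac{|x-y|^{\mu-1}}{\Gamma(\mu)}dy=\tfrac{\Gamma(c-a-b+1)}{\Gamma(c-a-b+\mu+1)}w_6(x;a-\mu,b-\mu,c-\mu).$$
   Context: Write $F(a,b;c;z)={}_2F_1(a,b;c;z)$ for the Gauss hypergeometric function (power series for $|z|<1$, analytically continued to $\mathbb{C}\setminus[1,\infty)$, with $c\notin\mathbb{Z}_{\le0}$). The six solutions of the hypergeometric differential equation on real intervals are $w_1(x;a,b,c)=F(a,b;c;x)$ for $x\in(-\infty,1)$; $w_2(x;a,b,c)=|x|^{1-c}F(a-c+1,b-c+1;2-c;x)$ for $x\in(-\infty,0)\cup(0,1)$; $w_3(x;a,b,c)=|x|^{-a}F(a,a-c+1;a-b+1;x^{-1})$ for $x\in(-\infty,0)\cup(1,\infty)$; $w_4(x;a,b,c)=|x|^{-b}F(b,b-c+1;b-a+1;x^{-1})$ for $x\in(-\infty,0)\cup(1,\infty)$; $w_5(x;a,b,c)=F(a,b;a+b-c+1;1-x)$ for $x\in(0,\infty)$; $w_6(x;a,b,c)=|1-x|^{c-a-b}F(c-a,c-b;c-a-b+1;1-x)$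 for $x\in(0,1)\cup(1,\infty)$. Integrals over sets such as $0<y/x<1$ are Lebesgue integrals over the set of real $y$ satisfying the condition (with $x$ fixed). *)

theory Defs
  imports "HOL-Complex_Analysis.Complex_Analysis"
begin

definition hyp2F1_series :: "complex \<Rightarrow> complex \<Rightarrow> complex \<Rightarrow> complex \<Rightarrow> complex" where
  "hyp2F1_series a b c z =
     (\<Sum>n. pochhammer a n * pochhammer b n / (pochhammer c n * fact n) * z ^ n)"

definition slit_plane :: "complex set" where
  "slit_plane = - (complex_of_real ` {1..})"

text \<open>
  The value at \<open>z\<close> of the analytic continuation of the Gauss series to the slit plane. The
  continuation is unique on the slit plane only, so the description selects its value at \<open>z\<close>
  rather than the function. The definition is meaningful for \<open>c \<notin> \<int>\<^sub>\<le>\<^sub>0\<close> and \<open>z \<in> slit_plane\<close>.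
\<close>
definition hyp2F1 :: "complex \<Rightarrow> complex \<Rightarrow> complex \<Rightarrow> complex \<Rightarrow> complex" where
  "hyp2F1 a b c z =
     (THE w. \<exists>f. f holomorphic_on slit_plane \<and>
                 (\<forall>u\<in>ball 0 1. f u = hyp2F1_series a b c u) \<and> f z = w)"

definition w1 :: "real \<Rightarrow> complex \<Rightarrow> complex \<Rightarrow> complex \<Rightarrow> complex" where
  "w1 x a b c = hyp2F1 a b c (of_real x)"

definition w2 :: "real \<Rightarrow> complex \<Rightarrow> complex \<Rightarrow> complex \<Rightarrow> complex" where
  "w2 x a b c = of_real \<bar>x\<bar> powr (1 - c) * hyp2F1 (a - c + 1) (b - c + 1) (2 - c) (of_real x)"

definition w3 :: "real \<Rightarrow> complex \<Rightarrow> complex \<Rightarrow> complex \<Rightarrow> complex" where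
  "w3 x a b c = of_real \<bar>x\<bar> powr (- a) * hyp2F1 a (a - c + 1) (a - b + 1) (of_real (inverse x))"

definition w4 :: "real \<Rightarrow> complex \<Rightarrow> complex \<Rightarrow> complex \<Rightarrow> complex" where
  "w4 x a b c = of_real \<bar>x\<bar> powr (- b) * hyp2F1 b (b - c + 1) (b - a + 1) (of_real (inverse x))"

definition w5 :: "real \<Rightarrow> complex \<Rightarrow> complex \<Rightarrow> complex \<Rightarrow> complex" where
  "w5 x a b c = hyp2F1 a b (a + b - c + 1) (of_real (1 - x))"

definition w6 :: "real \<Rightarrow> complex \<Rightarrow> complex \<Rightarrow> complex \<Rightarrow> complex" where
  "w6 x a b c = of_real \<bar>1 - x\<bar> powr (c - a - b) *
     hyp2F1 (c - a) (c - b) (c - a - b + 1) (of_real (1 - x))"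

text \<open>
  The Bochner integral of a non-integrable function is \<open>0\<close>, so the existence of the integral
  is part of the assertion that it has a given value.
\<close>
definition has_lebesgue_integral_on :: "(real \<Rightarrow> complex) \<Rightarrow> complex \<Rightarrow> real set \<Rightarrow> bool" where
  "has_lebesgue_integral_on f I S \<longleftrightarrow>
     set_integrable lborel S f \<and> (LINT y:S|lborel. f y) = I"

end

theory Submission
  imports Defs
begin

text \<open>
  The substitutions \<open>y = x t\<close>, \<open>y = x / t\<close> and \<open>y = 1 - (1 - x) t\<close> turn seven of the identities into
  integrals of \<open>F\<close> against the kernel \<open>t\<^sup>s\<^sup>-\<^sup>1 (1 - t)\<^sup>\<mu>\<^sup>-\<^sup>1\<close> on \<open>(0, 1)\<close>. Such an integral multiplies the
  \<open>n\<close>-th Taylor coefficient by \<open>B(s, \<mu>) (s)\<^sub>n / (s + \<mu>)\<^sub>n\<close> and is holomorphic on the slit plane, so the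
  identities hold on the unit disc by comparing coefficients and everywhere by analytic continuation.
  The weighted integrals of \<open>w\<^sub>5\<close> and \<open>w\<^sub>6\<close> are first simplified by Euler's transformation, which
  follows from the differential equation for formal power series.
  The remaining two identities (for \<open>w\<^sub>2\<close> and \<open>w\<^sub>5\<close> on a half line) are Weyl integrals of \<open>F(\<alpha>, \<beta>; \<gamma>; \<cdot>)\<close>.
  For \<open>Re \<gamma> > Re \<beta>\<close> insert the Euler integral and exchange the integrations; a contiguous relation
  then lowers \<open>\<gamma>\<close> step by step. The same scheme gives the continuation of the Gauss series.
\<close>

section \<open>Lebesgue integrals over sets of reals\<close>

lemma has_lebesgue_integral_on_iff_has_bochner_integral:
  "has_lebesgue_integral_on f I S \<longleftrightarrow> has_bochner_integral lborel (\<lambda>x. indicator S x *\<^sub>R f x) I"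
  by (simp add: has_lebesgue_integral_on_def set_integrable_def set_lebesgue_integral_def
      has_bochner_integral_iff)

lemma has_lebesgue_integral_on_spike:
  assumes "countable X" "\<And>x. x \<in> S - X \<Longrightarrow> f x = g x"
  shows "has_lebesgue_integral_on f I S \<longleftrightarrow> has_lebesgue_integral_on g I S"
  unfolding has_lebesgue_integral_on_iff_has_bochner_integral
  by (rule has_bochner_integral_discrete_difference[OF assms(1)])
     (use assms(2) in \<open>auto simp: indicator_def\<close>)

lemma has_lebesgue_integral_on_eq:
  assumes "\<And>x. x \<in> S \<Longrightarrow> f x = g x" "has_lebesgue_integral_on f I S"
  shows "has_lebesgue_integral_on g I S"
  using has_lebesgue_integral_on_spike[of "{}" S f g] assms by auto

lemma has_lebesgue_integral_on_add:
  assumes "has_lebesgue_integral_on f I S" "has_lebesgue_integral_on g J S"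
  shows "has_lebesgue_integral_on (\<lambda>x. f x + g x) (I + J) S"
  using assms by (auto simp: has_lebesgue_integral_on_def set_integral_add)

lemma has_lebesgue_integral_on_mult_right:
  assumes "has_lebesgue_integral_on f I S"
  shows "has_lebesgue_integral_on (\<lambda>x. k * f x) (k * I) S"
  using assms by (auto simp: has_lebesgue_integral_on_def)

lemma has_lebesgue_integral_on_mult_right_iff:
  assumes "k \<noteq> 0"
  shows "has_lebesgue_integral_on (\<lambda>x. k * f x) (k * I) S \<longleftrightarrow> has_lebesgue_integral_on f I S"
  using assms has_lebesgue_integral_on_mult_right[of f I S k]
    has_lebesgue_integral_on_mult_right[of "\<lambda>x. k * f x" "k * I" S "inverse k"]
  by (auto simp flip: mult.assoc)

lemma has_lebesgue_integral_on_iff_absolutely_integrable: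
  assumes "S \<in> sets borel" "continuous_on S f"
  shows "has_lebesgue_integral_on f I S \<longleftrightarrow> f absolutely_integrable_on S \<and> integral S f = I"
proof -
  have "(\<lambda>x. indicator S x *\<^sub>R f x) \<in> borel_measurable lborel"
    using borel_measurable_continuous_on_indicator[OF assms] by simp
  then have "has_lebesgue_integral_on f I S \<longleftrightarrow>
      has_bochner_integral lebesgue (\<lambda>x. indicator S x *\<^sub>R f x) I"
    by (simp add: has_lebesgue_integral_on_iff_has_bochner_integral has_bochner_integral_iff
        integrable_completion integral_completion)
  then show ?thesis
    using set_lebesgue_integral_eq_integral(2)[of S f]
    by (auto simp: has_bochner_integral_iff set_integrable_def set_lebesgue_integral_def)
qed

lemma has_lebesgue_integral_on_affine:
  assumes "m \<noteq> 0"
  shows "has_lebesgue_integral_on (\<lambda>t. of_real \<bar>m\<bar> * f (p + m * t)) I {t. p + m * t \<in> S} \<longleftrightarrow>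
    has_lebesgue_integral_on f I S"
proof -
  let ?g = "\<lambda>x. indicator S x *\<^sub>R f x"
  have "has_lebesgue_integral_on (\<lambda>t. of_real \<bar>m\<bar> * f (p + m * t)) I {t. p + m * t \<in> S} \<longleftrightarrow>
      has_lebesgue_integral_on (\<lambda>t. f (p + m * t)) (I /\<^sub>R \<bar>m\<bar>) {t. p + m * t \<in> S}"
    using assms has_lebesgue_integral_on_mult_right_iff[of "of_real \<bar>m\<bar>" _ "I /\<^sub>R \<bar>m\<bar>"]
    by (simp add: scaleR_conv_of_real flip: mult.assoc)
  also have "\<dots> \<longleftrightarrow> has_bochner_integral lborel (\<lambda>t. ?g (p + m * t)) (I /\<^sub>R \<bar>m\<bar>)"
    by (simp add: has_lebesgue_integral_on_iff_has_bochner_integral indicator_def)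
  also have "\<dots> \<longleftrightarrow> has_lebesgue_integral_on f I S"
    unfolding has_lebesgue_integral_on_iff_has_bochner_integral
    by (rule lborel_has_bochner_integral_real_affine_iff[OF assms, symmetric])
  finally show ?thesis .
qed

lemma has_lebesgue_integral_on_reflect:
  assumes "has_lebesgue_integral_on f I S"
  shows "has_lebesgue_integral_on (\<lambda>x. f (1 - x)) I {x. 1 - x \<in> S}"
  using has_lebesgue_integral_on_affine[of "- 1" f 1 I S] assms by simp

lemma has_lebesgue_integral_on_inverse:
  assumes "continuous_on {1<..} f"
  shows "has_lebesgue_integral_on (\<lambda>t. f (inverse t) / of_real t ^ 2) I {0<..<1} \<longleftrightarrow>
    has_lebesgue_integral_on f I {1<..}"
proof -
  have image: "inverse ` {0<..<1} = {1 :: real<..}"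
  proof -
    have "y \<in> inverse ` {0<..<1}" if "1 < y" for y :: real
      using that by (intro image_eqI[of _ _ "inverse y"]) (auto simp: inverse_less_1_iff)
    then show ?thesis by (auto simp: one_less_inverse)
  qed
  have deriv: "(inverse has_field_derivative - inverse (t ^ 2)) (at t within {0<..<1})"
    if "t \<in> {0<..<1}" for t :: real
    using that DERIV_inverse[of t "{0<..<1}"] by (simp add: power2_eq_square)
  have "continuous_on {0<..<1} (\<lambda>t. f (inverse t) / of_real t ^ 2)"
    using image by (intro continuous_intros continuous_on_compose2[OF assms]) auto
  then have "has_lebesgue_integral_on (\<lambda>t. f (inverse t) / of_real t ^ 2) I {0<..<1} \<longleftrightarrow>
      (\<lambda>t. \<bar>- inverse (t ^ 2)\<bar> *\<^sub>R f (inverse t)) absolutely_integrable_on {0<..<1} \<and>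
      integral {0<..<1} (\<lambda>t. \<bar>- inverse (t ^ 2)\<bar> *\<^sub>R f (inverse t)) = I"
    by (subst has_lebesgue_integral_on_iff_absolutely_integrable)
       (simp_all add: scaleR_conv_of_real divide_inverse mult.commute)
  also have "\<dots> \<longleftrightarrow> f absolutely_integrable_on {1<..} \<and> integral {1<..} f = I"
    using has_absolute_integral_change_of_variables_real[OF _ deriv, of f I] image
    by (simp add: inj_on_def)
  also have "\<dots> \<longleftrightarrow> has_lebesgue_integral_on f I {1<..}"
    by (rule has_lebesgue_integral_on_iff_absolutely_integrable[symmetric]) (simp_all add: assms)
  finally show ?thesis .
qed

text \<open>The integrals of the majorant \<open>g\<close> are complex-valued because in the applications \<open>g\<close> is
  \<open>f\<close> with its parameters replaced by their real parts.\<close>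
lemma integrable_product_continuous:
  fixes f g :: "real \<Rightarrow> real \<Rightarrow> complex"
  assumes S: "S \<in> sets borel" and T: "T \<in> sets borel"
    and f: "continuous_on (S \<times> T) (\<lambda>(s, t). f s t)" "\<And>s. s \<in> S \<Longrightarrow> set_integrable lborel T (f s)"
    and norm_f: "\<And>s t. s \<in> S \<Longrightarrow> t \<in> T \<Longrightarrow> of_real (norm (f s t)) = g s t"
    and g: "\<And>s. s \<in> S \<Longrightarrow> has_lebesgue_integral_on (g s) (G s) T" "set_integrable lborel S G"
  shows "integrable (lborel \<Otimes>\<^sub>M lborel) (\<lambda>p. indicator (S \<times> T) p *\<^sub>R (case p of (s, t) \<Rightarrow> f s t))"
proof -
  define F where "F = (\<lambda>p. indicator (S \<times> T) p *\<^sub>R (case p of (s, t) \<Rightarrow> f s t))"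
  have F: "F (s, t) = indicator S s *\<^sub>R (indicator T t *\<^sub>R f s t)" for s t
    by (auto simp: F_def indicator_def)
  have int_F: "integrable lborel (\<lambda>t. F (s, t))" for s
    using f(2)[of s] by (cases "s \<in> S") (auto simp: F set_integrable_def)
  have norm_F: "complex_of_real (LINT t|lborel. norm (F (s, t))) = indicator S s *\<^sub>R G s" for s
  proof (cases "s \<in> S")
    case True
    have "has_lebesgue_integral_on (\<lambda>t. of_real (norm (f s t))) (G s) T"
      using norm_f[OF True, symmetric] g(1)[OF True] by (rule has_lebesgue_integral_on_eq)
    then have "(LINT t|lborel. complex_of_real (norm (F (s, t)))) = G s"
      using True
      by (simp add: F has_lebesgue_integral_on_def set_lebesgue_integral_def scaleR_conv_of_real
          norm_mult)
    then show ?thesis using True by simp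
  qed (simp add: F)
  have "S \<times> T \<in> sets (borel :: (real \<times> real) measure)"
    using S T by (simp add: borel_prod[symmetric])
  then have "F \<in> borel_measurable borel"
    unfolding F_def by (rule borel_measurable_continuous_on_indicator[OF _ f(1)])
  then have "F \<in> borel_measurable (lborel \<Otimes>\<^sub>M lborel)"
    by (simp add: lborel_prod)
  moreover have "integrable lborel (\<lambda>s. complex_of_real (LINT t|lborel. norm (F (s, t))))"
    using g(2) by (simp add: norm_F set_integrable_def)
  ultimately have "integrable (lborel \<Otimes>\<^sub>M lborel) F"
    using int_F by (intro lborel_pair.Fubini_integrable) (auto simp: complex_of_real_integrable_eq)
  then show ?thesis by (simp only: F_def)
qed

lemma has_lebesgue_integral_on_Fubini:
  fixes f :: "real \<Rightarrow> real \<Rightarrow> complex"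
  assumes f: "integrable (lborel \<Otimes>\<^sub>M lborel) (\<lambda>p. indicator (S \<times> T) p *\<^sub>R (case p of (s, t) \<Rightarrow> f s t))"
    and f_T: "\<And>s. s \<in> S \<Longrightarrow> has_lebesgue_integral_on (f s) (I s) T"
    and f_S: "\<And>t. t \<in> T \<Longrightarrow> has_lebesgue_integral_on (\<lambda>s. f s t) (J t) S"
    and I: "has_lebesgue_integral_on I K S"
  shows "has_lebesgue_integral_on J K T"
proof -
  define F where "F = (\<lambda>p. indicator (S \<times> T) p *\<^sub>R (case p of (s, t) \<Rightarrow> f s t))"
  have F: "F (s, t) = indicator S s *\<^sub>R (indicator T t *\<^sub>R f s t)"
      "F (s, t) = indicator T t *\<^sub>R (indicator S s *\<^sub>R f s t)" for s t
    by (auto simp: F_def indicator_def)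
  have F_T: "has_bochner_integral lborel (\<lambda>t. F (s, t)) (indicator S s *\<^sub>R I s)" for s
    using f_T[of s]
    by (cases "s \<in> S") (auto simp: F(1) has_lebesgue_integral_on_iff_has_bochner_integral)
  have F_S: "has_bochner_integral lborel (\<lambda>s. F (s, t)) (indicator T t *\<^sub>R J t)" for t
    using f_S[of t]
    by (cases "t \<in> T") (auto simp: F(2) has_lebesgue_integral_on_iff_has_bochner_integral)
  have int_F: "integrable (lborel \<Otimes>\<^sub>M lborel) F"
    using f by (simp only: F_def)
  have "integrable (lborel \<Otimes>\<^sub>M lborel) (\<lambda>(t, s). F (s, t))"
    using lborel_pair.integrable_product_swap[OF int_F] by simp
  from lborel_pair.integrable_fst'[OF this] have "integrable lborel (\<lambda>t. indicator T t *\<^sub>R J t)"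
    using has_bochner_integral_integral_eq[OF F_S] by simp
  moreover have "(LINT t|lborel. indicator T t *\<^sub>R J t) = (LINT s|lborel. indicator S s *\<^sub>R I s)"
    using lborel_pair.Fubini_integral[of "\<lambda>s t. F (s, t)"] int_F
      has_bochner_integral_integral_eq[OF F_S] has_bochner_integral_integral_eq[OF F_T] by simp
  ultimately show ?thesis
    using I by (simp add: has_lebesgue_integral_on_iff_has_bochner_integral has_bochner_integral_iff)
qed

lemma set_borel_measurable_mult_continuous:
  fixes k h :: "'a :: topological_space \<Rightarrow> 'b :: {second_countable_topology, real_normed_algebra}"
  assumes k: "set_borel_measurable borel S k" and S: "S \<in> sets borel" and h: "continuous_on S h"
  shows "set_borel_measurable borel S (\<lambda>x. k x * h x)"
proof -
  have product: "indicator S x *\<^sub>R (k x * h x) = (indicator S x *\<^sub>R k x) * (indicator S x *\<^sub>R h x)"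
    for x
    by (auto simp: indicator_def)
  show ?thesis
    using k borel_measurable_continuous_on_indicator[OF S h]
    unfolding set_borel_measurable_def product by (rule borel_measurable_times)
qed

section \<open>Holomorphic dependence of integrals on a parameter\<close>

lemma holomorphic_Lipschitz_bound:
  assumes f: "f holomorphic_on A" and A: "open A" "cball z (2 * r) \<subseteq> A" and r: "r > 0"
    and bound: "\<And>w. w \<in> cball z (2 * r) \<Longrightarrow> norm (f w) \<le> B"
    and w: "w \<in> ball z r"
  shows "norm (f w - f z) \<le> B / r * norm (w - z)"
proof (rule field_differentiable_bound[where S = "ball z r" and f' = "deriv f"])
  fix u assume "u \<in> ball z r"
  then have cball_u: "cball u r \<subseteq> cball z (2 * r)"
    by (simp add: cball_subset_cball_iff dist_commute)
  then have "u \<in> A" using A(2) r by force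
  then show "(f has_field_derivative deriv f u) (at u within ball z r)"
    using f A(1) by (auto intro: holomorphic_derivI)
  have hol: "f holomorphic_on cball u r"
    using f by (rule holomorphic_on_subset) (use A(2) cball_u in blast)
  then have "norm ((deriv ^^ 1) f u) \<le> fact 1 * B / r ^ 1"
  proof (intro Cauchy_inequality r)
    show "f holomorphic_on ball u r" using hol ball_subset_cball by (rule holomorphic_on_subset)
    show "continuous_on (cball u r) f" using hol by (rule holomorphic_on_imp_continuous_on)
    show "norm (f x) \<le> B" if "norm (u - x) = r" for x
      using bound cball_u that by (force simp: dist_norm)
  qed
  then show "norm (deriv f u) \<le> B / r" by simp
qed (use w r in auto)

lemma integral_dominated_convergence_at:
  fixes s :: "'a :: first_countable_topology \<Rightarrow> 'b \<Rightarrow> 'c :: {banach, second_countable_topology}"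
  assumes meas: "eventually (\<lambda>w. s w \<in> borel_measurable M) (at z)"
    and lim: "\<And>t. t \<in> space M \<Longrightarrow> ((\<lambda>w. s w t) \<longlongrightarrow> f t) (at z)"
    and bound: "eventually (\<lambda>w. \<forall>t\<in>space M. norm (s w t) \<le> g t) (at z)"
    and g: "integrable M g"
  shows "((\<lambda>w. LINT t|M. s w t) \<longlongrightarrow> (LINT t|M. f t)) (at z)"
  unfolding tendsto_at_iff_sequentially comp_def
proof (intro allI impI)
  fix X assume X: "\<forall>i. X i \<in> UNIV - {z}" "X \<longlonglongrightarrow> z"
  then have X_at: "filterlim X (at z) sequentially"
    by (simp add: filterlim_at)
  obtain N where meas_X: "\<And>i. s (X (i + N)) \<in> borel_measurable M"
    and bound_X: "\<And>i t. t \<in> space M \<Longrightarrow> norm (s (X (i + N)) t) \<le> g t"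
    using eventually_compose_filterlim[OF eventually_conj[OF meas bound] X_at]
    by (auto simp: eventually_sequentially) (metis le_add2)
  have lim_X: "(\<lambda>i. s (X (i + N)) t) \<longlonglongrightarrow> f t" if "t \<in> space M" for t
    using filterlim_compose[OF lim[OF that] X_at] by (rule LIMSEQ_ignore_initial_segment)
  have "(\<lambda>i. LINT t|M. s (X (i + N)) t) \<longlonglongrightarrow> (LINT t|M. f t)"
  proof (rule integral_dominated_convergence)
    show "f \<in> borel_measurable M"
      by (rule borel_measurable_LIMSEQ_metric[OF meas_X lim_X])
  qed (use g meas_X lim_X bound_X in auto)
  then show "(\<lambda>i. LINT t|M. s (X i) t) \<longlonglongrightarrow> (LINT t|M. f t)"
    by (rule LIMSEQ_offset)
qed

lemma
  fixes f :: "complex \<Rightarrow> 'a \<Rightarrow> complex"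
  assumes R: "R > 0" and g: "integrable M g"
    and meas: "\<And>w. w \<in> ball z R \<Longrightarrow> f w \<in> borel_measurable M"
    and hol: "\<And>t. t \<in> space M \<Longrightarrow> (\<lambda>w. f w t) holomorphic_on ball z R"
    and bound: "\<And>w t. w \<in> ball z R \<Longrightarrow> t \<in> space M \<Longrightarrow> norm (f w t) \<le> g t"
  shows integrable_dominated_integrand: "w \<in> ball z R \<Longrightarrow> integrable M (f w)"
    and has_field_derivative_dominated_integral:
      "((\<lambda>w. LINT t|M. f w t) has_field_derivative (LINT t|M. deriv (\<lambda>w. f w t) z)) (at z)"
proof -
  show int: "integrable M (f w)" if w: "w \<in> ball z R" for w
  proof (rule Bochner_Integration.integrable_bound[OF g meas[OF w] AE_I2])
    show "norm (f w t) \<le> norm (g t)" if "t \<in> space M" for t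
      using bound[OF w that] by simp
  qed
  define q where "q w t = (f w t - f z t) / (w - z)" for w t
  have near_z: "eventually (\<lambda>w. w \<in> ball z (R / 3) - {z}) (at z)"
    using R by (intro eventually_at_in_open) auto
  have "((\<lambda>w. LINT t|M. q w t) \<longlongrightarrow> (LINT t|M. deriv (\<lambda>w. f w t) z)) (at z)"
  proof (rule integral_dominated_convergence_at)
    show "((\<lambda>w. q w t) \<longlongrightarrow> deriv (\<lambda>w. f w t) z) (at z)" if "t \<in> space M" for t
      using holomorphic_derivI[OF hol[OF that] open_ball, of z] R
      by (simp add: has_field_derivative_iff q_def)
    show "eventually (\<lambda>w. \<forall>t\<in>space M. norm (q w t) \<le> g t / (R / 3)) (at z)"
      using near_z
    proof eventually_elim
      case (elim w)
      then have "norm (f w t - f z t) \<le> g t / (R / 3) * norm (w - z)" if "t \<in> space M" for t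
        using R that
        by (intro holomorphic_Lipschitz_bound[OF hol[OF that] open_ball]) (auto intro: bound)
      then show ?case
        using elim by (simp add: q_def norm_divide divide_le_eq)
    qed
    show "eventually (\<lambda>w. q w \<in> borel_measurable M) (at z)"
      using near_z unfolding q_def
      by eventually_elim
         (use R in \<open>auto intro!: borel_measurable_divide borel_measurable_diff meas\<close>)
    show "integrable M (\<lambda>t. g t / (R / 3))" using g by simp
  qed
  moreover have "eventually (\<lambda>w. (LINT t|M. q w t) =
      ((LINT t|M. f w t) - (LINT t|M. f z t)) / (w - z)) (at z)"
    using near_z unfolding q_def by eventually_elim (use R in \<open>simp add: int\<close>)
  ultimately show "((\<lambda>w. LINT t|M. f w t) has_field_derivative (LINT t|M. deriv (\<lambda>w. f w t) z)) (at z)"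
    unfolding has_field_derivative_iff by (rule Lim_transform_eventually)
qed

lemma
  fixes f :: "complex \<Rightarrow> 'a \<Rightarrow> complex"
  assumes A: "open A"
    and meas: "\<And>z. z \<in> A \<Longrightarrow> f z \<in> borel_measurable M"
    and hol: "\<And>t. t \<in> space M \<Longrightarrow> (\<lambda>z. f z t) holomorphic_on A"
    and dominated: "\<And>z. z \<in> A \<Longrightarrow> \<exists>r>0. \<exists>g. ball z r \<subseteq> A \<and> integrable M g \<and>
      (\<forall>w\<in>ball z r. \<forall>t\<in>space M. norm (f w t) \<le> g t)"
  shows integrable_locally_dominated: "\<And>z. z \<in> A \<Longrightarrow> integrable M (f z)"
    and holomorphic_on_locally_dominated_integral: "(\<lambda>z. LINT t|M. f z t) holomorphic_on A"
proof -
  have int_deriv: "integrable M (f z) \<and>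
      ((\<lambda>z. LINT t|M. f z t) has_field_derivative (LINT t|M. deriv (\<lambda>z. f z t) z)) (at z)"
    if z: "z \<in> A" for z
  proof -
    obtain r g where r: "r > 0" "ball z r \<subseteq> A" "integrable M g"
      and bound: "\<And>w t. w \<in> ball z r \<Longrightarrow> t \<in> space M \<Longrightarrow> norm (f w t) \<le> g t"
      using dominated[OF z] by blast
    have "f w \<in> borel_measurable M" if "w \<in> ball z r" for w
      using meas r(2) that by blast
    moreover have "(\<lambda>w. f w t) holomorphic_on ball z r" if "t \<in> space M" for t
      using hol[OF that] r(2) by (rule holomorphic_on_subset)
    moreover have "z \<in> ball z r" using r(1) by simp
    ultimately show ?thesis
      using integrable_dominated_integrand[where f = f, OF r(1,3) _ _ bound]
        has_field_derivative_dominated_integral[where f = f, OF r(1,3) _ _ bound]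
      by blast
  qed
  show "integrable M (f z)" if "z \<in> A" for z
    using int_deriv[OF that] by blast
  show "(\<lambda>z. LINT t|M. f z t) holomorphic_on A"
    using A int_deriv by (auto simp: holomorphic_on_open)
qed

section \<open>Gamma and Beta integrals with complex exponents\<close>

lemma Re_pos_not_nonpos_Int: "Re z > 0 \<Longrightarrow> z \<notin> \<int>\<^sub>\<le>\<^sub>0"
  by (auto elim!: nonpos_Ints_cases)

lemma of_real_mult_powr:
  "x \<ge> 0 \<Longrightarrow> y \<ge> 0 \<Longrightarrow> complex_of_real (x * y) powr z = of_real x powr z * of_real y powr z"
  by (simp add: powr_times_real)

lemma of_real_inverse_powr:
  "x > 0 \<Longrightarrow> complex_of_real (inverse x) powr z = of_real x powr (- z)"
  using of_real_mult_powr[of x "inverse x" z] by (auto simp: powr_minus field_simps)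

lemma of_real_powr_plus_1:
  "x \<noteq> 0 \<Longrightarrow> complex_of_real x powr (z + 1) = of_real x * of_real x powr z"
  by (simp add: powr_add)

lemma of_real_norm_of_real_powr:
  "x > 0 \<Longrightarrow> complex_of_real (norm (complex_of_real x powr z)) = of_real x powr of_real (Re z)"
  by (simp add: norm_powr_real_powr powr_of_real)

lemma continuous_on_of_real_powr:
  assumes "continuous_on S g" "\<And>x. x \<in> S \<Longrightarrow> g x > 0"
  shows "continuous_on S (\<lambda>x. complex_of_real (g x) powr z)"
  by (intro continuous_on_powr_complex continuous_intros assms) (use assms(2) in \<open>force+\<close>)

lemma has_lebesgue_integral_on_Gamma:
  assumes z: "Re z > 0"
  shows "has_lebesgue_integral_on (\<lambda>t. of_real t powr (z - 1) * of_real (exp (- t))) (Gamma z) {0<..}"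
proof -
  have "continuous_on {0<..} (\<lambda>t. complex_of_real t powr (z - 1) * of_real (exp (- t)))"
    by (intro continuous_on_mult continuous_on_of_real_powr continuous_intros) auto
  then show ?thesis
    using absolutely_integrable_Gamma_integral'[OF z] Gamma_integral_complex'[OF z]
    by (simp add: has_lebesgue_integral_on_iff_absolutely_integrable exp_minus divide_inverse
        has_integral_iff)
qed

lemma has_lebesgue_integral_on_Gamma_scaled:
  assumes p: "p > 0" and z: "Re z > 0"
  shows "has_lebesgue_integral_on (\<lambda>t. of_real t powr (z - 1) * of_real (exp (- (p * t))))
           (Gamma z * of_real p powr (- z)) {0<..}"
proof -
  let ?f = "\<lambda>t. complex_of_real t powr (z - 1) * of_real (exp (- t))"
  have "{t. 0 + p * t \<in> {0<..}} = {0<..}"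
    using p by (auto simp: zero_less_mult_iff)
  then have "has_lebesgue_integral_on (\<lambda>t. of_real \<bar>p\<bar> * ?f (0 + p * t)) (Gamma z) {0<..}"
    using has_lebesgue_integral_on_affine[of p ?f 0 "Gamma z" "{0<..}"]
      has_lebesgue_integral_on_Gamma[OF z] p by simp
  then have "has_lebesgue_integral_on (\<lambda>t. of_real p powr (- z) * (of_real \<bar>p\<bar> * ?f (0 + p * t)))
      (of_real p powr (- z) * Gamma z) {0<..}"
    by (rule has_lebesgue_integral_on_mult_right)
  moreover have "of_real p powr (- z) * (of_real \<bar>p\<bar> * ?f (0 + p * t)) =
      of_real t powr (z - 1) * of_real (exp (- (p * t)))" if "t \<in> {0<..}" for t
  proof -
    have "complex_of_real p powr (- z) * of_real p * of_real p powr (z - 1) = 1"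
      using p of_real_powr_plus_1[of p "z - 1"] by (simp add: powr_minus field_simps)
    then show ?thesis
      using p that by (simp add: of_real_mult_powr mult_ac del: of_real_mult)
  qed
  ultimately show ?thesis
    unfolding mult.commute[of "Gamma z"] by (rule has_lebesgue_integral_on_eq[rotated])
qed

text \<open>The Gamma integrals for \<open>Gamma \<mu>\<close> and for \<open>Gamma \<alpha> (1 + u)\<^sup>-\<^sup>\<alpha>\<close> as the two iterated integrals of
  one function.\<close>
definition Gamma_pair_integrand :: "complex \<Rightarrow> complex \<Rightarrow> real \<Rightarrow> real \<Rightarrow> complex" where
  "Gamma_pair_integrand \<alpha> \<mu> s u = of_real s powr (\<alpha> - 1) * of_real (exp (- s)) *
     (of_real u powr (\<mu> - 1) * of_real (exp (- (s * u))))"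

lemma Gamma_pair_integral_inner:
  assumes "s > 0" "Re \<mu> > 0"
  shows "has_lebesgue_integral_on (Gamma_pair_integrand \<alpha> \<mu> s)
    (Gamma \<mu> * (of_real s powr (\<alpha> - \<mu> - 1) * of_real (exp (- s)))) {0<..}"
proof -
  have "of_real s powr (\<alpha> - \<mu> - 1) = complex_of_real s powr (\<alpha> - 1) * of_real s powr (- \<mu>)"
    by (simp add: algebra_simps flip: powr_add)
  then show ?thesis
    using has_lebesgue_integral_on_mult_right[OF has_lebesgue_integral_on_Gamma_scaled[OF assms],
        of "of_real s powr (\<alpha> - 1) * of_real (exp (- s))"]
    by (simp add: Gamma_pair_integrand_def[abs_def] mult_ac)
qed

lemma Gamma_pair_integral_outer:
  assumes "u > 0" "Re \<alpha> > 0"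
  shows "has_lebesgue_integral_on (\<lambda>s. Gamma_pair_integrand \<alpha> \<mu> s u)
    (of_real u powr (\<mu> - 1) * (Gamma \<alpha> * of_real (1 + u) powr (- \<alpha>))) {0<..}"
proof -
  have "has_lebesgue_integral_on (\<lambda>s. of_real u powr (\<mu> - 1) *
          (of_real s powr (\<alpha> - 1) * of_real (exp (- ((1 + u) * s)))))
      (of_real u powr (\<mu> - 1) * (Gamma \<alpha> * of_real (1 + u) powr (- \<alpha>))) {0<..}"
    using assms
    by (intro has_lebesgue_integral_on_mult_right has_lebesgue_integral_on_Gamma_scaled) auto
  moreover have "exp (- ((1 + u) * s)) = exp (- s) * exp (- (s * u))" for s
    by (simp add: algebra_simps flip: exp_add)
  ultimately show ?thesis
    by (simp add: Gamma_pair_integrand_def mult_ac)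
qed

lemma integrable_Gamma_pair_integrand:
  assumes \<mu>: "Re \<mu> > 0" and \<alpha>: "Re \<alpha> > Re \<mu>"
  shows "integrable (lborel \<Otimes>\<^sub>M lborel) (\<lambda>p. indicator ({0<..} \<times> {0<..}) p *\<^sub>R
    (case p of (s, u) \<Rightarrow> Gamma_pair_integrand \<alpha> \<mu> s u))"
proof (rule integrable_product_continuous)
  let ?\<alpha> = "complex_of_real (Re \<alpha>)" and ?\<mu> = "complex_of_real (Re \<mu>)"
  show "continuous_on ({0<..} \<times> {0<..}) (\<lambda>(s, u). Gamma_pair_integrand \<alpha> \<mu> s u)"
    unfolding Gamma_pair_integrand_def case_prod_unfold
    by (intro continuous_on_mult continuous_on_of_real_powr continuous_intros) auto
  show "of_real (norm (Gamma_pair_integrand \<alpha> \<mu> s u)) = Gamma_pair_integrand ?\<alpha> ?\<mu> s u"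
    if "s \<in> {0<..}" "u \<in> {0<..}" for s u
    using that by (simp add: Gamma_pair_integrand_def norm_mult of_real_norm_of_real_powr)
  show "set_integrable lborel {0<..} (Gamma_pair_integrand \<alpha> \<mu> s)" if "s \<in> {0<..}" for s
    using Gamma_pair_integral_inner[of s \<mu> \<alpha>] that \<mu> by (simp add: has_lebesgue_integral_on_def)
  show "has_lebesgue_integral_on (Gamma_pair_integrand ?\<alpha> ?\<mu> s)
      (Gamma ?\<mu> * (of_real s powr (?\<alpha> - ?\<mu> - 1) * of_real (exp (- s)))) {0<..}" if "s \<in> {0<..}" for s
    using that \<mu> by (intro Gamma_pair_integral_inner) auto
  have "has_lebesgue_integral_on (\<lambda>s. Gamma ?\<mu> * (of_real s powr (?\<alpha> - ?\<mu> - 1) * of_real (exp (- s))))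
      (Gamma ?\<mu> * Gamma (?\<alpha> - ?\<mu>)) {0<..}"
    using \<alpha> by (intro has_lebesgue_integral_on_mult_right has_lebesgue_integral_on_Gamma) simp
  then show "set_integrable lborel {0<..}
      (\<lambda>s. Gamma ?\<mu> * (of_real s powr (?\<alpha> - ?\<mu> - 1) * of_real (exp (- s))))"
    by (simp only: has_lebesgue_integral_on_def)
qed simp_all

lemma has_lebesgue_integral_on_Beta_half_line:
  assumes \<mu>: "Re \<mu> > 0" and \<alpha>: "Re \<alpha> > Re \<mu>"
  shows "has_lebesgue_integral_on (\<lambda>u. of_real (1 + u) powr (- \<alpha>) * of_real u powr (\<mu> - 1))
           (Beta \<mu> (\<alpha> - \<mu>)) {0<..}"
proof -
  have "has_lebesgue_integral_on
      (\<lambda>u. of_real u powr (\<mu> - 1) * (Gamma \<alpha> * of_real (1 + u) powr (- \<alpha>)))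
      (Gamma \<mu> * Gamma (\<alpha> - \<mu>)) {0<..}"
  proof (rule has_lebesgue_integral_on_Fubini[OF integrable_Gamma_pair_integrand[OF assms]])
    show "has_lebesgue_integral_on (Gamma_pair_integrand \<alpha> \<mu> s)
        (Gamma \<mu> * (of_real s powr (\<alpha> - \<mu> - 1) * of_real (exp (- s)))) {0<..}" if "s \<in> {0<..}" for s
      using that \<mu> by (intro Gamma_pair_integral_inner) auto
    show "has_lebesgue_integral_on (\<lambda>s. Gamma_pair_integrand \<alpha> \<mu> s u)
        (of_real u powr (\<mu> - 1) * (Gamma \<alpha> * of_real (1 + u) powr (- \<alpha>))) {0<..}" if "u \<in> {0<..}" for u
      using that \<mu> \<alpha> by (intro Gamma_pair_integral_outer) auto
    show "has_lebesgue_integral_on (\<lambda>s. Gamma \<mu> * (of_real s powr (\<alpha> - \<mu> - 1) * of_real (exp (- s))))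
        (Gamma \<mu> * Gamma (\<alpha> - \<mu>)) {0<..}"
      using \<alpha> by (intro has_lebesgue_integral_on_mult_right has_lebesgue_integral_on_Gamma) simp
  qed
  from has_lebesgue_integral_on_mult_right[OF this, of "inverse (Gamma \<alpha>)"]
  show ?thesis
    using Gamma_nonzero[OF Re_pos_not_nonpos_Int[of \<alpha>]] \<mu> \<alpha> by (simp add: Beta_def field_simps)
qed

lemma Beta_nonzero: "Re s > 0 \<Longrightarrow> Re \<mu> > 0 \<Longrightarrow> Beta s \<mu> \<noteq> (0 :: complex)"
  by (simp add: Beta_def Gamma_eq_zero_iff Re_pos_not_nonpos_Int)

definition beta_kernel :: "complex \<Rightarrow> complex \<Rightarrow> real \<Rightarrow> complex" where
  "beta_kernel s \<mu> t = of_real t powr (s - 1) * of_real (1 - t) powr (\<mu> - 1)"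

lemma beta_kernel_inverse:
  assumes t: "t \<in> {0<..<1}"
  shows "of_real (inverse t) powr (- s - \<mu>) * of_real (inverse t - 1) powr (\<mu> - 1) / of_real t ^ 2 =
    beta_kernel s \<mu> t"
proof -
  have "inverse t - 1 = inverse t * (1 - t)" using t by (simp add: field_simps)
  then have "of_real (inverse t - 1) powr (\<mu> - 1) =
      complex_of_real t powr (1 - \<mu>) * of_real (1 - t) powr (\<mu> - 1)"
    using t by (simp add: of_real_mult_powr of_real_inverse_powr
        del: of_real_inverse of_real_diff of_real_mult)
  moreover have "of_real t powr (s - 1) =
      complex_of_real t powr (s + \<mu>) * of_real t powr (1 - \<mu>) / of_real t ^ 2"
    using t powr_add[of "of_real t :: complex" "s - 1" 2]
    by (simp add: algebra_simps flip: powr_add)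
  ultimately show ?thesis
    using t of_real_inverse_powr[of t "- s - \<mu>"]
    by (simp add: beta_kernel_def add.commute mult.assoc del: of_real_inverse of_real_diff
        flip: times_divide_eq_right)
qed

lemma has_lebesgue_integral_on_beta_kernel:
  assumes s: "Re s > 0" and \<mu>: "Re \<mu> > 0"
  shows "has_lebesgue_integral_on (beta_kernel s \<mu>) (Beta s \<mu>) {0<..<1}"
proof -
  let ?f = "\<lambda>u. complex_of_real (1 + u) powr (- s - \<mu>) * of_real u powr (\<mu> - 1)"
    and ?g = "\<lambda>y. complex_of_real y powr (- s - \<mu>) * of_real (y - 1) powr (\<mu> - 1)"
  have "has_lebesgue_integral_on ?f (Beta s \<mu>) {0<..}"
    using has_lebesgue_integral_on_Beta_half_line[OF \<mu>, of "s + \<mu>"] s by (simp add: Beta_commute)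
  moreover have "{t :: real. - 1 + 1 * t \<in> {0<..}} = {1<..}" by auto
  ultimately have "has_lebesgue_integral_on ?g (Beta s \<mu>) {1<..}"
    using has_lebesgue_integral_on_affine[of 1 ?f "- 1" "Beta s \<mu>" "{0<..}"] by simp
  moreover have "continuous_on {1<..} ?g"
    by (intro continuous_on_mult continuous_on_of_real_powr continuous_intros) auto
  ultimately have "has_lebesgue_integral_on (\<lambda>t. ?g (inverse t) / of_real t ^ 2) (Beta s \<mu>) {0<..<1}"
    using has_lebesgue_integral_on_inverse[of ?g "Beta s \<mu>"] by blast
  with beta_kernel_inverse show ?thesis
    by (rule has_lebesgue_integral_on_eq)
qed

lemma Beta_plus_of_nat:
  assumes "Re s > 0" "Re \<mu> > 0"
  shows "Beta (s + of_nat n) \<mu> = Beta s \<mu> * (pochhammer s n / pochhammer (s + \<mu>) n)"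
proof (induction n)
  case (Suc n)
  have "s + \<mu> + of_nat n \<noteq> 0"
    using assms by (auto simp: complex_eq_iff)
  moreover have "(s + of_nat n + \<mu>) * Beta (s + of_nat n + 1) \<mu> =
      (s + of_nat n) * Beta (s + of_nat n) \<mu>"
    using assms by (intro Beta_plus1_left Re_pos_not_nonpos_Int) auto
  ultimately have "Beta (s + of_nat n + 1) \<mu> =
      (s + of_nat n) / (s + \<mu> + of_nat n) * Beta (s + of_nat n) \<mu>"
    by (simp add: field_simps)
  then show ?case
    unfolding Suc.IH by (simp add: pochhammer_Suc add_ac mult_ac)
qed simp

lemma set_integrable_beta_kernel:
  "Re s > 0 \<Longrightarrow> Re \<mu> > 0 \<Longrightarrow> set_integrable lborel {0<..<1} (beta_kernel s \<mu>)"
  using has_lebesgue_integral_on_beta_kernel by (simp add: has_lebesgue_integral_on_def)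

lemma beta_kernel_moment:
  assumes "Re s > 0" "Re \<mu> > 0"
  shows "(LINT t:{0<..<1}|lborel. beta_kernel s \<mu> t * of_real t ^ n) =
    Beta s \<mu> * (pochhammer s n / pochhammer (s + \<mu>) n)"
proof -
  have "has_lebesgue_integral_on (beta_kernel (s + of_nat n) \<mu>) (Beta (s + of_nat n) \<mu>) {0<..<1}"
    using assms by (intro has_lebesgue_integral_on_beta_kernel) auto
  moreover have "beta_kernel (s + of_nat n) \<mu> t = beta_kernel s \<mu> t * of_real t ^ n"
    if "t \<in> {0<..<1}" for t
    using that powr_add[of "complex_of_real t" "s - 1" "of_nat n"]
    by (simp add: beta_kernel_def powr_nat' algebra_simps)
  ultimately have "has_lebesgue_integral_on (\<lambda>t. beta_kernel s \<mu> t * of_real t ^ n)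
      (Beta (s + of_nat n) \<mu>) {0<..<1}"
    by (rule has_lebesgue_integral_on_eq[rotated])
  then show ?thesis
    by (simp add: has_lebesgue_integral_on_def Beta_plus_of_nat assms)
qed

section \<open>Scaled integrals of holomorphic functions\<close>

lemma scaled_bounded_near:
  fixes G :: "complex \<Rightarrow> complex"
  assumes A: "open A" and G: "continuous_on A G"
    and star: "\<And>t z. t \<in> {0..1} \<Longrightarrow> z \<in> A \<Longrightarrow> of_real t * z \<in> A" and z: "z \<in> A"
  obtains r B where "r > 0" "cball z r \<subseteq> A"
    "\<And>t w. t \<in> {0..1} \<Longrightarrow> w \<in> cball z r \<Longrightarrow> norm (G (of_real t * w)) \<le> B"
proof -
  obtain r where r: "r > 0" "cball z r \<subseteq> A"
    using A z by (auto simp: open_contains_cball)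
  have "compact ((\<lambda>(t, w). G (of_real t * w)) ` ({0..1} \<times> cball z r))"
    unfolding case_prod_unfold
    by (intro compact_continuous_image compact_Times continuous_on_compose2[OF G] continuous_intros)
       (use star r(2) in auto)
  then obtain B where "\<And>t w. t \<in> {0..1} \<Longrightarrow> w \<in> cball z r \<Longrightarrow> norm (G (of_real t * w)) \<le> B"
    by (fastforce dest: compact_imp_bounded simp: bounded_iff)
  then show ?thesis using r by (rule that[rotated -1])
qed

lemma holomorphic_on_scaled:
  assumes "G holomorphic_on A" "\<And>z. z \<in> A \<Longrightarrow> c * z \<in> A"
  shows "(\<lambda>z. G (c * z)) holomorphic_on A"
  by (rule holomorphic_on_compose_gen[OF _ assms(1), unfolded o_def])
     (auto intro!: holomorphic_intros assms(2))

lemma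
  fixes k :: "real \<Rightarrow> complex" and G :: "complex \<Rightarrow> complex"
  assumes k: "set_integrable lborel {0<..<1} k" and A: "open A" and G: "G holomorphic_on A"
    and star: "\<And>t z. t \<in> {0..1} \<Longrightarrow> z \<in> A \<Longrightarrow> of_real t * z \<in> A"
  shows set_integrable_mult_scaled:
      "\<And>z. z \<in> A \<Longrightarrow> set_integrable lborel {0<..<1} (\<lambda>t. k t * G (of_real t * z))"
    and holomorphic_on_set_integral_scaled:
      "(\<lambda>z. LINT t:{0<..<1}|lborel. k t * G (of_real t * z)) holomorphic_on A"
proof -
  define f where "f z t = indicator {0<..<1} t *\<^sub>R (k t * G (of_real t * z))" for z and t :: real
  have cont_G: "continuous_on A G"
    using G by (rule holomorphic_on_imp_continuous_on)
  have integrable_k: "integrable lborel (\<lambda>t. indicator {0<..<1} t *\<^sub>R k t)"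
    using k by (simp add: set_integrable_def)
  have meas: "f z \<in> borel_measurable lborel" if "z \<in> A" for z
  proof -
    have "continuous_on {0<..<1} (\<lambda>t. G (of_real t * z))"
      by (intro continuous_on_compose2[OF cont_G] continuous_intros) (use star that in auto)
    then show ?thesis
      using set_borel_measurable_mult_continuous[of "{0<..<1}" k] borel_measurable_integrable[OF integrable_k]
      by (simp add: f_def[abs_def] set_borel_measurable_def)
  qed
  have hol: "(\<lambda>z. f z t) holomorphic_on A" for t
    using holomorphic_on_scaled[OF G star, of t]
    by (cases "t \<in> {0<..<1}") (simp_all add: f_def holomorphic_on_mult)
  have dominated: "\<exists>r>0. \<exists>g. ball z r \<subseteq> A \<and> integrable lborel g \<and>
      (\<forall>w\<in>ball z r. \<forall>t\<in>space lborel. norm (f w t) \<le> g t)" if z: "z \<in> A" for z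
  proof -
    obtain r B where r: "r > 0" "cball z r \<subseteq> A"
      and B: "\<And>t w. t \<in> {0..1} \<Longrightarrow> w \<in> cball z r \<Longrightarrow> norm (G (of_real t * w)) \<le> B"
      using scaled_bounded_near[OF A cont_G star z] by blast
    have "norm (f w t) \<le> norm (indicator {0<..<1} t *\<^sub>R k t) * B" if "w \<in> ball z r" for w t
      using B[of t w] that by (auto simp: f_def norm_mult indicator_def intro!: mult_left_mono)
    moreover have "integrable lborel (\<lambda>t. norm (indicator {0<..<1} t *\<^sub>R k t) * B)"
      by (intro integrable_mult_left integrable_norm integrable_k)
    moreover have "ball z r \<subseteq> A" using r(2) ball_subset_cball by blast
    ultimately show ?thesis using r(1) by blast
  qed
  show "set_integrable lborel {0<..<1} (\<lambda>t. k t * G (of_real t * z))" if "z \<in> A" for z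
    using integrable_locally_dominated[OF A meas hol dominated that]
    by (simp add: f_def set_integrable_def)
  show "(\<lambda>z. LINT t:{0<..<1}|lborel. k t * G (of_real t * z)) holomorphic_on A"
    using holomorphic_on_locally_dominated_integral[OF A meas hol dominated]
    by (simp add: f_def set_lebesgue_integral_def)
qed

lemma sums_dominated_integral:
  fixes f :: "nat \<Rightarrow> 'a \<Rightarrow> 'b :: {banach, second_countable_topology}"
  assumes g: "integrable M g" and c: "summable c"
    and meas: "\<And>n. f n \<in> borel_measurable M"
    and bound: "\<And>n t. t \<in> space M \<Longrightarrow> norm (f n t) \<le> g t * c n"
    and sums: "\<And>t. t \<in> space M \<Longrightarrow> (\<lambda>n. f n t) sums F t"
  shows "(\<lambda>n. LINT t|M. f n t) sums (LINT t|M. F t)"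
proof -
  have bound_integrable: "integrable M (\<lambda>t. g t * c n)" for n
    using g by (rule integrable_mult_left)
  have integrable: "integrable M (f n)" for n
    by (rule Bochner_Integration.integrable_bound[OF bound_integrable[of n] meas AE_I2])
       (use bound in \<open>auto intro: order_trans[OF _ abs_ge_self]\<close>)
  have "(\<lambda>n. LINT t|M. f n t) sums (LINT t|M. (\<Sum>n. f n t))"
  proof (rule sums_integral[OF integrable])
    show "AE t in M. summable (\<lambda>n. norm (f n t))"
      using bound by (intro AE_I2 summable_comparison_test'[OF summable_mult[OF c]]) simp
    have "norm (LINT t|M. norm (f n t)) \<le> (LINT t|M. g t) * c n" for n
      using integral_mono[OF integrable_norm[OF integrable] bound_integrable bound] by simp
    then show "summable (\<lambda>n. LINT t|M. norm (f n t))"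
      by (intro summable_comparison_test'[OF summable_mult[OF c]])
  qed
  also have "(LINT t|M. (\<Sum>n. f n t)) = (LINT t|M. F t)"
    using sums by (intro Bochner_Integration.integral_cong) (auto simp: sums_iff)
  finally show ?thesis .
qed

lemma set_integral_scaled_power_series:
  fixes k :: "real \<Rightarrow> complex" and g :: "nat \<Rightarrow> complex"
  assumes k: "set_integrable lborel {0<..<1} k"
    and G: "\<And>u. u \<in> ball 0 R \<Longrightarrow> (\<lambda>n. g n * u ^ n) sums G u" and z: "z \<in> ball 0 R"
  shows "(\<lambda>n. (LINT t:{0<..<1}|lborel. k t * of_real t ^ n) * g n * z ^ n) sums
    (LINT t:{0<..<1}|lborel. k t * G (of_real t * z))"
proof -
  define k' where "k' t = indicator {0<..<1} t *\<^sub>R k t" for t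
  define f where "f n t = k' t * of_real t ^ n * (g n * z ^ n)" for n t
  have integrable_k': "integrable lborel k'"
    using k by (simp add: set_integrable_def k'_def[abs_def])
  obtain r where r: "norm z < r" "r < R"
    using z dense by auto
  then have "r > 0" using norm_ge_zero[of z] by linarith
  then have "(\<lambda>n. g n * of_real r ^ n) sums G (of_real r)" "norm z < norm (complex_of_real r)"
    using r by (auto intro!: G)
  then have "summable (\<lambda>n. norm (g n * z ^ n))"
    by (auto intro: powser_insidea dest: sums_summable)
  then have "(\<lambda>n. LINT t|lborel. f n t) sums (LINT t|lborel. k' t * G (of_real t * z))"
  proof (rule sums_dominated_integral[OF integrable_norm[OF integrable_k']])
    show "f n \<in> borel_measurable lborel" for n
      using borel_measurable_integrable[OF integrable_k'] unfolding f_def by measurable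
    show "norm (f n t) \<le> norm (k' t) * norm (g n * z ^ n)" for n t
      by (auto simp: f_def k'_def norm_mult norm_power indicator_def power_le_one
          intro!: mult_right_mono mult_right_le_one_le)
    show "(\<lambda>n. f n t) sums (k' t * G (of_real t * z))" for t
    proof (cases "t \<in> {0<..<1}")
      case True
      then have "norm (of_real t * z) \<le> norm z"
        by (simp add: norm_mult mult_left_le_one_le)
      then have "(\<lambda>n. g n * (of_real t * z) ^ n) sums G (of_real t * z)"
        using z by (intro G) simp
      from sums_mult[OF this, of "k' t"] show ?thesis
        by (simp add: f_def power_mult_distrib mult_ac)
    qed (simp add: f_def k'_def)
  qed
  moreover have "(LINT t|lborel. f n t) =
      (LINT t:{0<..<1}|lborel. k t * of_real t ^ n) * g n * z ^ n" for n
    unfolding f_def k'_def set_lebesgue_integral_def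
    by (simp only: integral_mult_left_zero mult_scaleR_left[of _ "k _"] mult.assoc[of "integral\<^sup>L _ _"])
  ultimately show ?thesis
    by (simp add: k'_def set_lebesgue_integral_def)
qed

section \<open>The slit plane\<close>

lemma slit_plane_iff: "z \<in> slit_plane \<longleftrightarrow> Im z \<noteq> 0 \<or> Re z < 1"
proof -
  have "z \<in> complex_of_real ` {1..} \<longleftrightarrow> Im z = 0 \<and> Re z \<ge> 1"
    by (auto simp: image_iff complex_eq_iff)
  then show ?thesis by (auto simp: slit_plane_def)
qed

lemma of_real_in_slit_plane_iff: "of_real x \<in> slit_plane \<longleftrightarrow> x < 1"
  by (simp add: slit_plane_iff)

lemma open_slit_plane: "open slit_plane"
proof -
  have "slit_plane = {z. Im z \<noteq> 0} \<union> {z. Re z < 1}"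
    by (auto simp: slit_plane_iff)
  moreover have "open \<dots>"
    by (intro open_Un open_Collect_neq open_Collect_less continuous_intros)
  ultimately show ?thesis by simp
qed

lemma scale_slit_plane:
  assumes "t \<in> {0..1}" "z \<in> slit_plane"
  shows "of_real t * z \<in> slit_plane"
proof (cases "t = 0 \<or> Im z \<noteq> 0")
  case False
  then have "t * Re z < t * 1"
    using assms by (intro mult_strict_left_mono) (auto simp: slit_plane_iff)
  then show ?thesis using assms(1) by (simp add: slit_plane_iff)
qed (auto simp: slit_plane_iff)

lemma ball_subset_slit_plane: "ball 0 1 \<subseteq> slit_plane"
proof
  fix z :: complex assume "z \<in> ball 0 1"
  then have "Re z < 1" using complex_Re_le_cmod[of z] by simp
  then show "z \<in> slit_plane" by (simp add: slit_plane_iff)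
qed

lemma connected_slit_plane: "connected slit_plane"
proof -
  have "closed_segment 0 z \<subseteq> slit_plane" if "z \<in> slit_plane" for z
    using scale_slit_plane[OF _ that] by (auto simp: closed_segment_def scaleR_conv_of_real)
  then have "starlike slit_plane"
    unfolding starlike_def by (intro bexI[of _ 0]) (auto simp: slit_plane_iff)
  then show ?thesis by (rule starlike_imp_connected)
qed

lemma holomorphic_slit_plane_eqI:
  assumes "f holomorphic_on slit_plane" "g holomorphic_on slit_plane"
    and "\<And>u. u \<in> ball 0 1 \<Longrightarrow> f u = g u" and "z \<in> slit_plane"
  shows "f z = g z"
  using analytic_continuation_open[of "ball 0 1" slit_plane f g z] assms
    ball_subset_slit_plane open_slit_plane connected_slit_plane by auto

lemma holomorphic_one_minus_powr: "(\<lambda>z. (1 - z) powr k) holomorphic_on slit_plane"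
  by (intro holomorphic_intros) (auto simp: slit_plane_iff complex_nonpos_Reals_iff)

section \<open>The Gauss series\<close>

lemma plus_of_nat_neq_0: "c \<notin> \<int>\<^sub>\<le>\<^sub>0 \<Longrightarrow> c + of_nat n \<noteq> (0 :: 'a :: ring_char_0)"
  using plus_of_nat_eq_0_imp by blast

lemma plus_1_not_nonpos_Int: "c \<notin> \<int>\<^sub>\<le>\<^sub>0 \<Longrightarrow> c + 1 \<notin> (\<int>\<^sub>\<le>\<^sub>0 :: 'a :: ring_char_0 set)"
  using plus_one_in_nonpos_Ints_imp by blast

lemma plus_2_not_nonpos_Int: "c \<notin> \<int>\<^sub>\<le>\<^sub>0 \<Longrightarrow> c + 2 \<notin> (\<int>\<^sub>\<le>\<^sub>0 :: 'a :: ring_char_0 set)"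
  using plus_1_not_nonpos_Int[OF plus_1_not_nonpos_Int[of c]] by (simp add: add.assoc)

lemma pochhammer_neq_0: "c \<notin> \<int>\<^sub>\<le>\<^sub>0 \<Longrightarrow> pochhammer c n \<noteq> (0 :: 'a :: field_char_0)"
  using pochhammer_eq_0_imp_nonpos_Int by blast

definition fps_2F1 :: "'a \<Rightarrow> 'a \<Rightarrow> 'a \<Rightarrow> 'a :: field_char_0 fps" where
  "fps_2F1 a b c = fps_hypergeo [a, b] [c] 1"

lemma fps_2F1_nth:
  "fps_nth (fps_2F1 a b c) n = pochhammer a n * pochhammer b n / (pochhammer c n * fact n)"
  by (simp add: fps_2F1_def)

lemma fps_2F1_nth_Suc:
  assumes "c \<notin> \<int>\<^sub>\<le>\<^sub>0"
  shows "of_nat (Suc n) * (c + of_nat n) * fps_nth (fps_2F1 a b c) (Suc n) =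
    (a + of_nat n) * (b + of_nat n) * fps_nth (fps_2F1 a b c) n"
  using plus_of_nat_neq_0[OF assms, of n] of_nat_neq_0[of n, where 'a = 'a]
  unfolding fps_2F1_def fps_hypergeo_rec by (simp del: of_nat_Suc fps_hypergeo_nth)

lemma fps_2F1_raise_denominator:
  assumes c: "c \<notin> \<int>\<^sub>\<le>\<^sub>0"
  shows "fps_2F1 a b c = fps_2F1 a b (c + 1) +
    fps_const (a * b / (c * (c + 1))) * fps_X * fps_2F1 (a + 1) (b + 1) (c + 2)"
proof (rule fps_ext)
  fix n
  show "fps_nth (fps_2F1 a b c) n = fps_nth (fps_2F1 a b (c + 1) +
    fps_const (a * b / (c * (c + 1))) * fps_X * fps_2F1 (a + 1) (b + 1) (c + 2)) n"
  proof (cases n)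
    case (Suc m)
    define P where "P = a * pochhammer (a + 1) m * (b * pochhammer (b + 1) m) /
      (pochhammer (c + 1) m * fact m)"
    have nonzero: "c \<noteq> 0" "c + 1 \<noteq> 0" "c + 1 + of_nat m \<noteq> 0" "of_nat (Suc m) \<noteq> (0 :: 'a)"
      using plus_of_nat_neq_0[OF c, of 0] plus_of_nat_neq_0[OF c, of 1]
        plus_of_nat_neq_0[OF c, of "Suc m"] of_nat_neq_0[of m] by (simp_all add: add_ac)
    have pochhammer_shift: "pochhammer (c + 1) m * (c + 1 + of_nat m) = (c + 1) * pochhammer (c + 2) m"
      using pochhammer_rec[of "c + 1" m] by (simp add: pochhammer_Suc add.assoc)
    have "fps_nth (fps_2F1 a b c) n = P / (c * of_nat (Suc m))"
      by (simp add: Suc P_def fps_2F1_nth pochhammer_rec mult_ac del: of_nat_Suc)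
    moreover have "fps_nth (fps_2F1 a b (c + 1)) n = P / ((c + 1 + of_nat m) * of_nat (Suc m))"
      by (simp add: Suc P_def fps_2F1_nth pochhammer_rec[of a] pochhammer_rec[of b]
          pochhammer_Suc[of "c + 1"] mult_ac del: of_nat_Suc)
    moreover have "a * b / (c * (c + 1)) * fps_nth (fps_2F1 (a + 1) (b + 1) (c + 2)) m =
        a * b * (pochhammer (a + 1) m * pochhammer (b + 1) m) /
        (c * ((c + 1) * pochhammer (c + 2) m) * fact m)"
      by (simp add: fps_2F1_nth mult_ac)
    then have "a * b / (c * (c + 1)) * fps_nth (fps_2F1 (a + 1) (b + 1) (c + 2)) m =
        P / (c * (c + 1 + of_nat m))"
      by (simp add: P_def mult_ac flip: pochhammer_shift)
    moreover have "P / (c * k) = P / (d * k) + P / (c * d)" if "k \<noteq> 0" "d \<noteq> 0" "d = c + k" for k d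
      using that(1,2) nonzero(1) by (simp add: divide_simps) (simp add: that(3) algebra_simps)
    then have "P / (c * of_nat (Suc m)) =
        P / ((c + 1 + of_nat m) * of_nat (Suc m)) + P / (c * (c + 1 + of_nat m))"
      using nonzero by (simp add: add.assoc)
    ultimately show ?thesis
      by (simp add: Suc mult.assoc del: of_nat_Suc)
  qed (simp add: fps_2F1_nth)
qed

lemma fps_2F1_raise_numerator:
  assumes c: "c \<notin> \<int>\<^sub>\<le>\<^sub>0"
  shows "fps_2F1 a b c =
    fps_2F1 a (b + 1) c + fps_const (- a / c) * fps_X * fps_2F1 (a + 1) (b + 1) (c + 1)"
proof (rule fps_ext)
  fix n
  show "fps_nth (fps_2F1 a b c) n = fps_nth (fps_2F1 a (b + 1) c +
    fps_const (- a / c) * fps_X * fps_2F1 (a + 1) (b + 1) (c + 1)) n"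
  proof (cases n)
    case (Suc m)
    define P where "P = a * pochhammer (a + 1) m * pochhammer (b + 1) m /
      (c * pochhammer (c + 1) m * fact m)"
    have nonzero: "of_nat (Suc m) \<noteq> (0 :: 'a)" by (rule of_nat_neq_0)
    have pochhammer_shift: "pochhammer (b + 1) (Suc m) = pochhammer (b + 1) m * (b + of_nat (Suc m))"
      by (simp add: pochhammer_Suc add_ac)
    have "fps_nth (fps_2F1 a b c) n = P * (b / of_nat (Suc m))"
      by (simp add: Suc P_def fps_2F1_nth pochhammer_rec mult_ac del: of_nat_Suc)
    moreover have "fps_nth (fps_2F1 a (b + 1) c) n = P * ((b + of_nat (Suc m)) / of_nat (Suc m))"
      unfolding Suc fps_2F1_nth pochhammer_shift
      by (simp add: P_def pochhammer_rec[of a] pochhammer_rec[of c] mult_ac del: of_nat_Suc)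
    moreover have "- a / c * fps_nth (fps_2F1 (a + 1) (b + 1) (c + 1)) m = - P"
      by (simp add: P_def fps_2F1_nth mult_ac)
    moreover have "b / of_nat (Suc m) = (b + of_nat (Suc m)) / of_nat (Suc m) - 1"
      using nonzero by (simp add: divide_simps del: of_nat_Suc)
    ultimately show ?thesis
      by (simp add: Suc mult.assoc right_diff_distrib del: of_nat_Suc)
  qed (simp add: fps_2F1_nth)
qed

lemma tendsto_plus_of_nat_quotient:
  fixes a c :: "'a :: {real_normed_field, banach}"
  assumes "c \<notin> \<int>\<^sub>\<le>\<^sub>0"
  shows "(\<lambda>n. (a + of_nat n) / (c + of_nat n)) \<longlonglongrightarrow> 1"
proof -
  have "(\<lambda>n. 1 + (a - c) / (c + of_nat n)) \<longlonglongrightarrow> 1 + 0"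
    by (intro tendsto_intros tendsto_divide_0[OF tendsto_const]
        tendsto_add_filterlim_at_infinity[OF tendsto_const] tendsto_of_nat)
  moreover have "1 + (a - c) / (c + of_nat n) = (a + of_nat n) / (c + of_nat n)" for n
    using plus_of_nat_neq_0[OF assms, of n] by (simp add: field_simps)
  ultimately show ?thesis by simp
qed

lemma fps_conv_radius_2F1:
  fixes a b c :: "'a :: {real_normed_field, banach}"
  assumes c: "c \<notin> \<int>\<^sub>\<le>\<^sub>0"
  shows "fps_conv_radius (fps_2F1 a b c) \<ge> 1"
proof (cases "a \<in> \<int>\<^sub>\<le>\<^sub>0 \<or> b \<in> \<int>\<^sub>\<le>\<^sub>0")
  case True
  then obtain k where "a = - of_nat k \<or> b = - of_nat k"
    by (auto elim!: nonpos_Ints_cases')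
  then have "eventually (\<lambda>n. fps_nth (fps_2F1 a b c) n = 0) sequentially"
    by (intro eventually_mono[OF eventually_gt_at_top[of k]])
       (auto simp: fps_2F1_nth pochhammer_eq_0_iff)
  then show ?thesis
    by (simp add: fps_conv_radius_def conv_radius_cong[where g = "\<lambda>_. 0"])
next
  case False
  have "norm (fps_nth (fps_2F1 a b c) n) / norm (fps_nth (fps_2F1 a b c) (Suc n)) =
      norm ((c + of_nat n) / (a + of_nat n) * ((1 + of_nat n) / (b + of_nat n)))" for n
    using False pochhammer_neq_0[of a n] pochhammer_neq_0[of b n] pochhammer_neq_0[OF c, of n]
    by (simp add: fps_2F1_nth pochhammer_Suc norm_mult norm_divide divide_simps)
  moreover have "(\<lambda>n. norm ((c + of_nat n) / (a + of_nat n) * ((1 + of_nat n) / (b + of_nat n))))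
      \<longlonglongrightarrow> norm (1 * 1 :: 'a)"
    using False by (intro tendsto_intros tendsto_plus_of_nat_quotient) auto
  ultimately have "conv_radius (fps_nth (fps_2F1 a b c)) = 1"
    by (intro conv_radius_ratio_limit_nonzero[of _ 1]) (simp_all add: one_ereal_def)
  then show ?thesis by (simp add: fps_conv_radius_def)
qed

lemma norm_less_fps_conv_radius_2F1:
  fixes a b c :: "'a :: {real_normed_field, banach}"
  assumes "c \<notin> \<int>\<^sub>\<le>\<^sub>0" "z \<in> ball 0 1"
  shows "ereal (norm z) < fps_conv_radius (fps_2F1 a b c)"
proof -
  have "ereal (norm z) < 1" using assms(2) by simp
  then show ?thesis
    using fps_conv_radius_2F1[OF assms(1)] by (rule less_le_trans)
qed

lemma eval_fps_add_const_X_mult: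
  fixes f g :: "'a :: {banach, real_normed_div_algebra, comm_ring_1} fps"
  assumes "norm z < fps_conv_radius f" "norm z < fps_conv_radius g"
  shows "eval_fps (f + fps_const k * fps_X * g) z = eval_fps f z + k * z * eval_fps g z"
proof -
  have radius: "fps_conv_radius (fps_const k * fps_X :: 'a fps) = \<infinity>"
    using fps_conv_radius_mult[of "fps_const k" "fps_X :: 'a fps"] by simp
  then have "norm z < fps_conv_radius (fps_const k * fps_X * g)"
    using assms(2) fps_conv_radius_mult[of "fps_const k * fps_X" g] by (auto elim: less_le_trans)
  then show ?thesis
    using assms radius by (simp add: eval_fps_add eval_fps_mult)
qed

lemma hyp2F1_series_eq_eval_fps: "hyp2F1_series a b c z = eval_fps (fps_2F1 a b c) z"
  by (simp add: hyp2F1_series_def eval_fps_def fps_2F1_nth)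

lemma sums_hyp2F1_series:
  assumes "c \<notin> \<int>\<^sub>\<le>\<^sub>0" "z \<in> ball 0 1"
  shows "(\<lambda>n. fps_nth (fps_2F1 a b c) n * z ^ n) sums hyp2F1_series a b c z"
  unfolding hyp2F1_series_eq_eval_fps
  by (rule sums_eval_fps[OF norm_less_fps_conv_radius_2F1[OF assms]])

lemma hyp2F1_series_raise_denominator:
  assumes c: "c \<notin> \<int>\<^sub>\<le>\<^sub>0" and z: "z \<in> ball 0 1"
  shows "hyp2F1_series a b c z = hyp2F1_series a b (c + 1) z +
    a * b / (c * (c + 1)) * z * hyp2F1_series (a + 1) (b + 1) (c + 2) z"
  unfolding hyp2F1_series_eq_eval_fps fps_2F1_raise_denominator[OF c, of a b]
  by (intro eval_fps_add_const_X_mult norm_less_fps_conv_radius_2F1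
      plus_1_not_nonpos_Int plus_2_not_nonpos_Int c z)

lemma hyp2F1_series_raise_numerator:
  assumes c: "c \<notin> \<int>\<^sub>\<le>\<^sub>0" and z: "z \<in> ball 0 1"
  shows "hyp2F1_series a b c z = hyp2F1_series a (b + 1) c z +
    - a / c * z * hyp2F1_series (a + 1) (b + 1) (c + 1) z"
  unfolding hyp2F1_series_eq_eval_fps fps_2F1_raise_numerator[OF c, of a b]
  by (intro eval_fps_add_const_X_mult norm_less_fps_conv_radius_2F1 plus_1_not_nonpos_Int c z)

lemma hyp2F1_series_1_1:
  assumes "z \<in> ball 0 1"
  shows "hyp2F1_series a 1 1 z = (1 - z) powr (- a)"
proof -
  have "(- a gchoose n) * (- z) ^ n =
      pochhammer a n * pochhammer 1 n / (pochhammer 1 n * fact n) * z ^ n" for n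
    by (simp add: gbinomial_pochhammer power_minus[of z] pochhammer_neq_0 mult_ac)
  then show ?thesis
    using gen_binomial_complex[of "- z" "- a"] assms by (simp add: hyp2F1_series_def sums_iff)
qed

section \<open>Euler's transformation of the Gauss series\<close>

definition fps_2F1_ode :: "'a \<Rightarrow> 'a \<Rightarrow> 'a \<Rightarrow> 'a fps \<Rightarrow> 'a :: field_char_0 fps" where
  "fps_2F1_ode a b c f = fps_X * (1 - fps_X) * fps_deriv (fps_deriv f) +
     (fps_const c - (fps_const a + fps_const b + 1) * fps_X) * fps_deriv f -
     fps_const a * fps_const b * f"

lemma fps_2F1_ode_nth:
  "fps_nth (fps_2F1_ode a b c f) n =
     of_nat (Suc n) * (c + of_nat n) * fps_nth f (Suc n) -
     (a + of_nat n) * (b + of_nat n) * fps_nth f n"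
proof -
  have expand: "fps_2F1_ode a b c f =
      fps_X * fps_deriv (fps_deriv f) - fps_X * (fps_X * fps_deriv (fps_deriv f)) +
      fps_const c * fps_deriv f - fps_const (a + b + 1) * (fps_X * fps_deriv f) - fps_const (a * b) * f"
    unfolding fps_2F1_ode_def by (simp add: algebra_simps flip: fps_const_add fps_const_mult)
  show ?thesis
    unfolding expand by (cases n; cases "n - 1") (auto simp: algebra_simps)
qed

lemma fps_2F1_ode_2F1:
  assumes "c \<notin> \<int>\<^sub>\<le>\<^sub>0"
  shows "fps_2F1_ode a b c (fps_2F1 a b c) = 0"
  by (rule fps_ext) (use fps_2F1_nth_Suc[OF assms] in \<open>simp add: fps_2F1_ode_nth\<close>)

lemma fps_2F1_ode_unique:
  assumes c: "c \<notin> \<int>\<^sub>\<le>\<^sub>0" and f: "fps_2F1_ode a b c f = 0" and g: "fps_2F1_ode a b c g = 0"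
    and "fps_nth f 0 = fps_nth g 0"
  shows "f = g"
proof (rule fps_ext)
  show "fps_nth f n = fps_nth g n" for n
  proof (induction n)
    case (Suc n)
    have "of_nat (Suc n) * (c + of_nat n) * fps_nth f (Suc n) =
        of_nat (Suc n) * (c + of_nat n) * fps_nth g (Suc n)"
      using fps_2F1_ode_nth[of a b c f n] fps_2F1_ode_nth[of a b c g n] f g Suc.IH by simp
    then show ?case
      using plus_of_nat_neq_0[OF c, of n] by (simp del: of_nat_Suc)
  qed (rule assms)
qed

text \<open>The hypotheses on \<open>P'\<close> and \<open>P''\<close> say that \<open>P\<close> behaves like \<open>(1 - x)\<^sup>K\<close> with first and second
  derivatives \<open>P'\<close> and \<open>P''\<close>; \<open>f'\<close> and \<open>f''\<close> play the same role for \<open>f\<close>.\<close>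
lemma hypergeometric_ode_mult_power:
  fixes x :: "'a :: comm_ring_1"
  assumes deriv_P: "(1 - x) * P' = - K * P" and deriv2_P: "(1 - x) * P'' = P' - K * P'"
    and K: "K = A + B - C"
    and ode: "x * (1 - x) * f'' + (C - (A + B + 1) * x) * f' - A * B * f = 0"
  shows "(1 - x)^2 * (x * (1 - x) * (P'' * f + 2 * P' * f' + P * f'') +
    (C - ((C - A) + (C - B) + 1) * x) * (P' * f + P * f') - (C - A) * (C - B) * (P * f)) = 0"
proof -
  have "(1 - x)^2 * P'' = (1 - K) * ((1 - x) * P')"
    unfolding power2_eq_square mult.assoc deriv2_P by (simp add: algebra_simps)
  then have second: "(1 - x)^2 * P'' = (1 - K) * (- K * P)" unfolding deriv_P .
  have "(1 - x)^2 * (x * (1 - x) * (P'' * f + 2 * P' * f' + P * f'') +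
    (C - ((C - A) + (C - B) + 1) * x) * (P' * f + P * f') - (C - A) * (C - B) * (P * f)) =
    x * (1 - x) * (((1 - x)^2 * P'') * f + 2 * (1 - x) * ((1 - x) * P') * f' + (1 - x)^2 * P * f'') +
    (C - ((C - A) + (C - B) + 1) * x) * ((1 - x) * ((1 - x) * P') * f + (1 - x)^2 * P * f') -
    (C - A) * (C - B) * ((1 - x)^2 * P * f)"
    by (simp add: algebra_simps power2_eq_square)
  also have "\<dots> = (1 - x)^2 * P * (x * (1 - x) * f'' + (C - (A + B + 1) * x) * f' - A * B * f)"
    unfolding second deriv_P K by (simp add: algebra_simps power2_eq_square)
  finally show ?thesis unfolding ode by simp
qed

lemma fps_deriv_2F1_1_1: "(1 - fps_X) * fps_deriv (fps_2F1 k 1 1) = fps_const k * fps_2F1 k 1 1"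
proof (rule fps_ext)
  fix n
  have "of_nat (Suc n) * fps_nth (fps_2F1 k 1 1) (Suc n) = (k + of_nat n) * fps_nth (fps_2F1 k 1 1) n"
    by (simp add: fps_2F1_nth pochhammer_neq_0 pochhammer_Suc[of k] del: of_nat_Suc)
  then show "fps_nth ((1 - fps_X) * fps_deriv (fps_2F1 k 1 1)) n =
      fps_nth (fps_const k * fps_2F1 k 1 1) n"
    by (cases n) (auto simp: algebra_simps)
qed

lemma fps_2F1_Euler_transformation:
  assumes c: "c \<notin> \<int>\<^sub>\<le>\<^sub>0"
  shows "fps_2F1 a b c = fps_2F1 (a + b - c) 1 1 * fps_2F1 (c - a) (c - b) c"
proof -
  define k where "k = (c - a) + (c - b) - c"
  define P where "P = fps_2F1 (- k) 1 1"
  define f where "f = fps_2F1 (c - a) (c - b) c"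
  have deriv_P: "(1 - fps_X) * fps_deriv P = - fps_const k * P"
    using fps_deriv_2F1_1_1[of "- k"] by (simp add: P_def)
  have deriv2_P: "(1 - fps_X) * fps_deriv (fps_deriv P) = fps_deriv P - fps_const k * fps_deriv P"
    using arg_cong[OF deriv_P, of fps_deriv] by (simp add: algebra_simps del: fps_const_neg)
  have "(1 - fps_X)^2 * fps_2F1_ode (c - (c - a)) (c - (c - b)) c (P * f) = 0"
    using hypergeometric_ode_mult_power[OF deriv_P deriv2_P, of
        "fps_const (c - a)" "fps_const (c - b)" "fps_const c" "fps_deriv (fps_deriv f)" "fps_deriv f" f] fps_2F1_ode_2F1[OF c, of "c - a" "c - b"]
    unfolding fps_2F1_ode_def k_def f_def[symmetric]
    by (simp add: algebra_simps)
  moreover have "fps_nth (1 - fps_X :: 'a fps) 0 \<noteq> fps_nth 0 0" by simp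
  then have "(1 - fps_X)^2 \<noteq> (0 :: 'a fps)" by (metis power_eq_0_iff)
  ultimately have "fps_2F1_ode a b c (P * f) = 0" by simp
  from fps_2F1_ode_unique[OF c fps_2F1_ode_2F1[OF c] this] have "fps_2F1 a b c = P * f"
    by (simp add: P_def f_def fps_2F1_nth)
  moreover have "- k = a + b - c" by (simp add: k_def)
  ultimately show ?thesis by (simp only: P_def f_def)
qed

lemma hyp2F1_series_Euler_transformation:
  assumes c: "c \<notin> \<int>\<^sub>\<le>\<^sub>0" and z: "z \<in> ball 0 1"
  shows "hyp2F1_series a b c z = (1 - z) powr (c - a - b) * hyp2F1_series (c - a) (c - b) c z"
proof -
  have "hyp2F1_series a b c z = hyp2F1_series (a + b - c) 1 1 z * hyp2F1_series (c - a) (c - b) c z"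
    unfolding hyp2F1_series_eq_eval_fps fps_2F1_Euler_transformation[OF c, of a b]
    by (intro eval_fps_mult norm_less_fps_conv_radius_2F1 c z) simp
  then show ?thesis
    using hyp2F1_series_1_1[OF z, of "a + b - c"] by (simp add: algebra_simps)
qed

section \<open>Analytic continuation\<close>

definition continues_hyp2F1 :: "(complex \<Rightarrow> complex) \<Rightarrow> complex \<Rightarrow> complex \<Rightarrow> complex \<Rightarrow> bool" where
  "continues_hyp2F1 f a b c \<longleftrightarrow>
     f holomorphic_on slit_plane \<and> (\<forall>u\<in>ball 0 1. f u = hyp2F1_series a b c u)"

lemma hyp2F1_eqI:
  assumes f: "continues_hyp2F1 f a b c" and z: "z \<in> slit_plane"
  shows "hyp2F1 a b c z = f z"
proof -
  have "(THE w. \<exists>g. continues_hyp2F1 g a b c \<and> g z = w) = f z"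
  proof (rule the_equality)
    show "\<exists>g. continues_hyp2F1 g a b c \<and> g z = f z"
      using f by blast
    fix w assume "\<exists>g. continues_hyp2F1 g a b c \<and> g z = w"
    then obtain g where g: "continues_hyp2F1 g a b c" "g z = w" by blast
    then have "g z = f z"
      using f
      by (intro holomorphic_slit_plane_eqI[of g f, OF _ _ _ z]) (auto simp: continues_hyp2F1_def)
    then show "w = f z" using g(2) by simp
  qed
  then show ?thesis
    by (simp only: hyp2F1_def continues_hyp2F1_def conj_assoc)
qed

lemma continues_hyp2F1_one_minus_powr: "continues_hyp2F1 (\<lambda>z. (1 - z) powr (- a)) a 1 1"
  by (simp add: continues_hyp2F1_def holomorphic_one_minus_powr hyp2F1_series_1_1)

lemma continues_hyp2F1_beta_kernel:
  assumes s: "Re s > 0" "Re \<mu> > 0" and G: "continues_hyp2F1 G a b c" and c: "c \<notin> \<int>\<^sub>\<le>\<^sub>0" "c' \<notin> \<int>\<^sub>\<le>\<^sub>0"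
    and coeffs: "\<And>n. pochhammer s n / pochhammer (s + \<mu>) n * fps_nth (fps_2F1 a b c) n =
      fps_nth (fps_2F1 a' b' c') n"
  shows "continues_hyp2F1
    (\<lambda>z. (LINT t:{0<..<1}|lborel. beta_kernel s \<mu> t * G (of_real t * z)) / Beta s \<mu>) a' b' c'"
proof -
  define T where "T z = (LINT t:{0<..<1}|lborel. beta_kernel s \<mu> t * G (of_real t * z))" for z
  note kernel = set_integrable_beta_kernel[OF s]
  have "T holomorphic_on slit_plane"
    unfolding T_def using G scale_slit_plane
    by (intro holomorphic_on_set_integral_scaled kernel open_slit_plane)
       (auto simp: continues_hyp2F1_def)
  then have "(\<lambda>z. T z / Beta s \<mu>) holomorphic_on slit_plane"
    using Beta_nonzero[OF s] by (intro holomorphic_intros) auto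
  moreover have "T u / Beta s \<mu> = hyp2F1_series a' b' c' u" if u: "u \<in> ball 0 1" for u
  proof -
    have "(\<lambda>n. (LINT t:{0<..<1}|lborel. beta_kernel s \<mu> t * of_real t ^ n) *
        fps_nth (fps_2F1 a b c) n * u ^ n) sums T u"
      unfolding T_def using sums_hyp2F1_series[OF c(1)] G
      by (intro set_integral_scaled_power_series[OF kernel _ u]) (auto simp: continues_hyp2F1_def)
    from sums_divide[OF this, of "Beta s \<mu>"]
    have "(\<lambda>n. fps_nth (fps_2F1 a' b' c') n * u ^ n) sums (T u / Beta s \<mu>)"
      using Beta_nonzero[OF s] by (simp add: beta_kernel_moment s mult.assoc flip: coeffs)
    then show ?thesis
      using sums_hyp2F1_series[OF c(2) u] by (rule sums_unique2)
  qed
  ultimately show ?thesis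
    by (simp add: continues_hyp2F1_def T_def)
qed

lemma has_lebesgue_integral_on_beta_kernel_mult:
  assumes s: "Re s > 0" "Re \<mu> > 0" and G: "continues_hyp2F1 G a b c" and c: "c \<notin> \<int>\<^sub>\<le>\<^sub>0" "c' \<notin> \<int>\<^sub>\<le>\<^sub>0"
    and coeffs: "\<And>n. pochhammer s n / pochhammer (s + \<mu>) n * fps_nth (fps_2F1 a b c) n =
      fps_nth (fps_2F1 a' b' c') n"
    and z: "z \<in> slit_plane"
  shows "has_lebesgue_integral_on (\<lambda>t. beta_kernel s \<mu> t * G (of_real t * z))
    (Beta s \<mu> * hyp2F1 a' b' c' z) {0<..<1}"
proof -
  have "set_integrable lborel {0<..<1} (\<lambda>t. beta_kernel s \<mu> t * G (of_real t * z))"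
    using G scale_slit_plane
    by (intro set_integrable_mult_scaled[OF set_integrable_beta_kernel[OF s] open_slit_plane _ _ z])
       (auto simp: continues_hyp2F1_def)
  then show ?thesis
    using hyp2F1_eqI[OF continues_hyp2F1_beta_kernel[OF s G c coeffs] z] Beta_nonzero[OF s]
    by (simp add: has_lebesgue_integral_on_def)
qed

lemma
  assumes b: "Re b > 0" "Re c > Re b"
  shows Euler_integral_continues_hyp2F1: "\<exists>f. continues_hyp2F1 f a b c"
    and Euler_integral: "\<And>z. z \<in> slit_plane \<Longrightarrow>
      has_lebesgue_integral_on (\<lambda>t. beta_kernel b (c - b) t * (1 - of_real t * z) powr (- a))
        (Beta b (c - b) * hyp2F1 a b c z) {0<..<1}"
proof -
  have \<mu>: "Re (c - b) > 0" using b by simp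
  have c: "c \<notin> \<int>\<^sub>\<le>\<^sub>0" using b by (intro Re_pos_not_nonpos_Int) simp
  have coeffs: "pochhammer b n / pochhammer (b + (c - b)) n * fps_nth (fps_2F1 a 1 1) n =
      fps_nth (fps_2F1 a b c) n" for n
    by (simp add: fps_2F1_nth pochhammer_neq_0)
  show "\<exists>f. continues_hyp2F1 f a b c"
    using continues_hyp2F1_beta_kernel[OF b(1) \<mu> continues_hyp2F1_one_minus_powr
        one_notin_nonpos_Ints c coeffs]
    by blast
  show "has_lebesgue_integral_on (\<lambda>t. beta_kernel b (c - b) t * (1 - of_real t * z) powr (- a))
      (Beta b (c - b) * hyp2F1 a b c z) {0<..<1}" if "z \<in> slit_plane" for z
    by (rule has_lebesgue_integral_on_beta_kernel_mult[OF b(1) \<mu> continues_hyp2F1_one_minus_powr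
          one_notin_nonpos_Ints c coeffs that])
qed

lemma continues_hyp2F1_add_mult:
  assumes f: "continues_hyp2F1 f a b c" and g: "continues_hyp2F1 g a' b' c'"
    and series: "\<And>u. u \<in> ball 0 1 \<Longrightarrow>
      hyp2F1_series a'' b'' c'' u = hyp2F1_series a b c u + k * u * hyp2F1_series a' b' c' u"
  shows "continues_hyp2F1 (\<lambda>z. f z + k * z * g z) a'' b'' c''"
  using assms by (auto simp: continues_hyp2F1_def intro!: holomorphic_intros)

text \<open>The Euler integral gives the continuation for \<open>Re c > Re b > 0\<close>; the contiguous relations
  remove first the condition on \<open>c\<close>, then the one on \<open>b\<close>.\<close>
lemma hyp2F1_continuation_exists_Re_pos:
  assumes "Re b > 0" "c \<notin> \<int>\<^sub>\<le>\<^sub>0"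
  shows "\<exists>f. continues_hyp2F1 f a b c"
proof -
  obtain n where "real n > Re b - Re c"
    using reals_Archimedean2 by blast
  then have "Re c + real n > Re b" by simp
  then show ?thesis
    using assms
  proof (induction n arbitrary: a b c)
    case 0
    then show ?case by (intro Euler_integral_continues_hyp2F1) auto
  next
    case (Suc n)
    note shifted_c = plus_1_not_nonpos_Int[OF Suc.prems(3)] plus_2_not_nonpos_Int[OF Suc.prems(3)]
    obtain f where f: "continues_hyp2F1 f a b (c + 1)"
      using Suc.IH[of b "c + 1" a] Suc.prems shifted_c by auto
    obtain g where g: "continues_hyp2F1 g (a + 1) (b + 1) (c + 2)"
      using Suc.IH[of "b + 1" "c + 2" "a + 1"] Suc.prems shifted_c by auto
    from continues_hyp2F1_add_mult[OF f g hyp2F1_series_raise_denominator[OF Suc.prems(3)]]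
    show ?case by blast
  qed
qed

lemma hyp2F1_continuation_exists:
  assumes "c \<notin> \<int>\<^sub>\<le>\<^sub>0"
  shows "\<exists>f. continues_hyp2F1 f a b c"
proof -
  obtain n where "real n > - Re b"
    using reals_Archimedean2 by blast
  then have "Re b + real n > 0" by simp
  then show ?thesis
    using assms
  proof (induction n arbitrary: a b c)
    case 0
    then show ?case by (intro hyp2F1_continuation_exists_Re_pos) auto
  next
    case (Suc n)
    note shifted_c = plus_1_not_nonpos_Int[OF Suc.prems(2)]
    obtain f where f: "continues_hyp2F1 f a (b + 1) c"
      using Suc.IH[of "b + 1" c a] Suc.prems by auto
    obtain g where g: "continues_hyp2F1 g (a + 1) (b + 1) (c + 1)"
      using Suc.IH[of "b + 1" "c + 1" "a + 1"] Suc.prems shifted_c by auto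
    from continues_hyp2F1_add_mult[OF f g hyp2F1_series_raise_numerator[OF Suc.prems(2)]]
    show ?case by blast
  qed
qed

lemma continues_hyp2F1_hyp2F1:
  assumes "c \<notin> \<int>\<^sub>\<le>\<^sub>0"
  shows "continues_hyp2F1 (hyp2F1 a b c) a b c"
proof -
  obtain f where f: "continues_hyp2F1 f a b c"
    using hyp2F1_continuation_exists[OF assms] by blast
  then have "hyp2F1 a b c holomorphic_on slit_plane"
    using hyp2F1_eqI[OF f] by (auto simp: continues_hyp2F1_def intro: holomorphic_transform)
  then show ?thesis
    using f hyp2F1_eqI[OF f] ball_subset_slit_plane by (auto simp: continues_hyp2F1_def)
qed

lemma holomorphic_hyp2F1: "c \<notin> \<int>\<^sub>\<le>\<^sub>0 \<Longrightarrow> hyp2F1 a b c holomorphic_on slit_plane"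
  using continues_hyp2F1_hyp2F1 by (simp add: continues_hyp2F1_def)

lemma hyp2F1_eq_series: "c \<notin> \<int>\<^sub>\<le>\<^sub>0 \<Longrightarrow> u \<in> ball 0 1 \<Longrightarrow> hyp2F1 a b c u = hyp2F1_series a b c u"
  using continues_hyp2F1_hyp2F1 by (simp add: continues_hyp2F1_def)

lemma continuous_on_hyp2F1_of_real:
  assumes "c \<notin> \<int>\<^sub>\<le>\<^sub>0" "continuous_on S h" "\<And>y. y \<in> S \<Longrightarrow> h y < 1"
  shows "continuous_on S (\<lambda>y. hyp2F1 a b c (of_real (h y)))"
  by (rule continuous_on_compose2[OF
        holomorphic_on_imp_continuous_on[OF holomorphic_hyp2F1[OF assms(1)]]])
     (auto intro!: continuous_intros assms simp: of_real_in_slit_plane_iff)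

lemma hyp2F1_commute: "hyp2F1 a b c z = hyp2F1 b a c z"
  by (simp add: hyp2F1_def hyp2F1_series_def mult.commute[of "pochhammer a _"])

lemma hyp2F1_raise_denominator:
  assumes c: "c \<notin> \<int>\<^sub>\<le>\<^sub>0" and z: "z \<in> slit_plane"
  shows "hyp2F1 a b c z = hyp2F1 a b (c + 1) z +
    a * b / (c * (c + 1)) * z * hyp2F1 (a + 1) (b + 1) (c + 2) z"
  by (rule hyp2F1_eqI[OF continues_hyp2F1_add_mult[OF
        continues_hyp2F1_hyp2F1[OF plus_1_not_nonpos_Int[OF c]]
        continues_hyp2F1_hyp2F1[OF plus_2_not_nonpos_Int[OF c]]
        hyp2F1_series_raise_denominator[OF c]] z])

lemma hyp2F1_Euler_transformation:
  assumes c: "c \<notin> \<int>\<^sub>\<le>\<^sub>0" and z: "z \<in> slit_plane"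
  shows "hyp2F1 a b c z = (1 - z) powr (c - a - b) * hyp2F1 (c - a) (c - b) c z"
proof (rule hyp2F1_eqI[OF _ z])
  show "continues_hyp2F1 (\<lambda>z. (1 - z) powr (c - a - b) * hyp2F1 (c - a) (c - b) c z) a b c"
    using hyp2F1_series_Euler_transformation[OF c, of _ a b] hyp2F1_eq_series[OF c]
    by (simp add: continues_hyp2F1_def holomorphic_on_mult holomorphic_one_minus_powr
        holomorphic_hyp2F1[OF c])
qed

lemma Bateman_integral_denominator:
  assumes c: "Re c > 0" and \<mu>: "Re \<mu> > 0" and z: "z \<in> slit_plane"
  shows "has_lebesgue_integral_on (\<lambda>t. beta_kernel c \<mu> t * hyp2F1 a b c (of_real t * z))
           (Beta c \<mu> * hyp2F1 a b (c + \<mu>) z) {0<..<1}"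
proof -
  have nonpos: "c \<notin> \<int>\<^sub>\<le>\<^sub>0" "c + \<mu> \<notin> \<int>\<^sub>\<le>\<^sub>0"
    using c \<mu> by (auto intro!: Re_pos_not_nonpos_Int)
  show ?thesis
  proof (rule has_lebesgue_integral_on_beta_kernel_mult[OF c \<mu> continues_hyp2F1_hyp2F1 _ _ _ z])
    show "pochhammer c n / pochhammer (c + \<mu>) n * fps_nth (fps_2F1 a b c) n =
        fps_nth (fps_2F1 a b (c + \<mu>)) n" for n
      using pochhammer_neq_0[OF nonpos(1), of n] by (simp add: fps_2F1_nth)
  qed (fact nonpos)+
qed

lemma Bateman_integral_numerator:
  assumes s: "Re s > 0" and \<mu>: "Re \<mu> > 0" and c: "c \<notin> \<int>\<^sub>\<le>\<^sub>0" and z: "z \<in> slit_plane"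
  shows "has_lebesgue_integral_on (\<lambda>t. beta_kernel s \<mu> t * hyp2F1 (s + \<mu>) b c (of_real t * z))
           (Beta s \<mu> * hyp2F1 s b c z) {0<..<1}"
proof (rule has_lebesgue_integral_on_beta_kernel_mult[OF s \<mu> continues_hyp2F1_hyp2F1[OF c] c c _ z])
  have "s + \<mu> \<notin> \<int>\<^sub>\<le>\<^sub>0" using s \<mu> by (intro Re_pos_not_nonpos_Int) simp
  then show "pochhammer s n / pochhammer (s + \<mu>) n * fps_nth (fps_2F1 (s + \<mu>) b c) n =
      fps_nth (fps_2F1 s b c) n" for n
    using pochhammer_neq_0[of "s + \<mu>" n] by (simp add: fps_2F1_nth)
qed

section \<open>Fractional integrals on the unit interval\<close>

definition fractional_kernel :: "complex \<Rightarrow> real \<Rightarrow> complex" where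
  "fractional_kernel \<mu> h = of_real h powr (\<mu> - 1) / Gamma \<mu>"

lemma fractional_kernel_mult:
  "h \<ge> 0 \<Longrightarrow> k \<ge> 0 \<Longrightarrow> fractional_kernel \<mu> (h * k) = of_real h powr (\<mu> - 1) * fractional_kernel \<mu> k"
  by (simp add: fractional_kernel_def of_real_mult_powr del: of_real_mult)

lemma mult_fractional_kernel:
  assumes "Re \<mu> > 0" "h > 0"
  shows "of_real h * fractional_kernel \<mu> h = \<mu> * fractional_kernel (\<mu> + 1) h"
proof -
  have "\<mu> \<noteq> 0" using assms by auto
  then show ?thesis
    using assms of_real_powr_plus_1[of h "\<mu> - 1"]
    by (simp add: fractional_kernel_def Gamma_plus1 Re_pos_not_nonpos_Int)
qed

lemma norm_fractional_kernel:
  assumes "Re \<mu> > 0" "h > 0"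
  shows "of_real (norm (fractional_kernel \<mu> h)) =
    Gamma (of_real (Re \<mu>)) / of_real (norm (Gamma \<mu>)) * fractional_kernel (of_real (Re \<mu>)) h"
  using assms Gamma_nonzero[OF Re_pos_not_nonpos_Int[of "of_real (Re \<mu>)"]]
  by (simp add: fractional_kernel_def norm_divide of_real_norm_of_real_powr)

lemma continuous_on_fractional_kernel:
  assumes "continuous_on S g" "\<And>x. x \<in> S \<Longrightarrow> g x > 0"
  shows "continuous_on S (\<lambda>x. fractional_kernel \<mu> (g x))"
  unfolding fractional_kernel_def divide_inverse
  by (intro continuous_on_mult continuous_on_of_real_powr continuous_on_const assms)

lemma Riemann_Liouville_beta_kernel:
  assumes x: "x \<noteq> 0"
    and J: "has_lebesgue_integral_on (\<lambda>t. beta_kernel s \<mu> t * G (x * t)) J {0<..<1}"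
  shows "has_lebesgue_integral_on (\<lambda>y. of_real \<bar>y\<bar> powr (s - 1) * G y * fractional_kernel \<mu> \<bar>x - y\<bar>)
    (of_real \<bar>x\<bar> powr (s + \<mu> - 1) * (J / Gamma \<mu>)) {y. 0 < y / x \<and> y / x < 1}"
proof -
  let ?f = "\<lambda>y. of_real \<bar>y\<bar> powr (s - 1) * G y * fractional_kernel \<mu> \<bar>x - y\<bar>"
  have "of_real \<bar>x\<bar> powr (s + \<mu> - 1) / Gamma \<mu> * (beta_kernel s \<mu> t * G (x * t)) =
      of_real \<bar>x\<bar> * ?f (0 + x * t)" if t: "t \<in> {0<..<1}" for t
  proof -
    have "x - x * t = x * (1 - t)" by (simp add: right_diff_distrib)
    then have "\<bar>x * t\<bar> = \<bar>x\<bar> * t" "\<bar>x - x * t\<bar> = \<bar>x\<bar> * (1 - t)"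
      using t by (simp_all only: abs_mult) simp_all
    moreover have "of_real \<bar>x\<bar> powr (s + \<mu> - 1) =
        complex_of_real \<bar>x\<bar> * of_real \<bar>x\<bar> powr (s - 1) * of_real \<bar>x\<bar> powr (\<mu> - 1)"
      using x of_real_powr_plus_1[of "\<bar>x\<bar>" "s - 1 + (\<mu> - 1)"]
        powr_add[of "complex_of_real \<bar>x\<bar>" "s - 1" "\<mu> - 1"] by (simp add: algebra_simps)
    ultimately show ?thesis
      using t by (simp add: beta_kernel_def fractional_kernel_mult fractional_kernel_def[of _ "1 - t"]
          of_real_mult_powr del: of_real_mult of_real_diff)
  qed
  from has_lebesgue_integral_on_eq[OF this has_lebesgue_integral_on_mult_right[OF J]]
  have "has_lebesgue_integral_on (\<lambda>t. of_real \<bar>x\<bar> * ?f (0 + x * t))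
      (of_real \<bar>x\<bar> powr (s + \<mu> - 1) * (J / Gamma \<mu>)) {0<..<1}"
    by simp
  moreover have "{t. 0 + x * t \<in> {y. 0 < y / x \<and> y / x < 1}} = {0<..<1}"
    using x by auto
  ultimately show ?thesis
    using has_lebesgue_integral_on_affine[OF x, of ?f 0 _ "{y. 0 < y / x \<and> y / x < 1}"] by simp
qed

lemma Weyl_beta_kernel:
  assumes x: "x \<noteq> 0" and G: "continuous_on {1<..} (\<lambda>u. G (x * u))"
    and J: "has_lebesgue_integral_on (\<lambda>t. beta_kernel s \<mu> t * G (x * inverse t)) J {0<..<1}"
  shows "has_lebesgue_integral_on (\<lambda>y. of_real \<bar>y\<bar> powr (- s - \<mu>) * G y * fractional_kernel \<mu> \<bar>x - y\<bar>)
    (of_real \<bar>x\<bar> powr (- s) * (J / Gamma \<mu>)) {y. y / x > 1}"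
proof -
  let ?f = "\<lambda>y. of_real \<bar>y\<bar> powr (- s - \<mu>) * G y * fractional_kernel \<mu> \<bar>x - y\<bar>"
  let ?g = "\<lambda>u. of_real u powr (- s - \<mu>) * of_real (u - 1) powr (\<mu> - 1) * G (x * u)"
  have "beta_kernel s \<mu> t * G (x * inverse t) = ?g (inverse t) / of_real t ^ 2" if "t \<in> {0<..<1}" for t
    unfolding beta_kernel_inverse[OF that, symmetric] by simp
  from has_lebesgue_integral_on_eq[OF this J]
  have "has_lebesgue_integral_on (\<lambda>t. ?g (inverse t) / of_real t ^ 2) J {0<..<1}" .
  moreover have "continuous_on {1<..} ?g"
    by (intro continuous_on_mult continuous_on_of_real_powr continuous_intros G) auto
  ultimately have "has_lebesgue_integral_on ?g J {1<..}"
    using has_lebesgue_integral_on_inverse[of ?g J] by blast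
  note scaled_J = has_lebesgue_integral_on_mult_right[OF this, of "of_real \<bar>x\<bar> powr (- s) / Gamma \<mu>"]
  have "of_real \<bar>x\<bar> powr (- s) / Gamma \<mu> * ?g u = of_real \<bar>x\<bar> * ?f (0 + x * u)" if u: "u \<in> {1<..}" for u
  proof -
    have "x - x * u = x * (1 - u)" by (simp add: right_diff_distrib)
    then have "\<bar>x * u\<bar> = \<bar>x\<bar> * u" "\<bar>x - x * u\<bar> = \<bar>x\<bar> * (u - 1)"
      using u by (simp_all only: abs_mult) simp_all
    moreover have "of_real \<bar>x\<bar> powr (- s) =
        complex_of_real \<bar>x\<bar> * of_real \<bar>x\<bar> powr (- s - \<mu>) * of_real \<bar>x\<bar> powr (\<mu> - 1)"
      using x of_real_powr_plus_1[of "\<bar>x\<bar>" "- s - \<mu> + (\<mu> - 1)"]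
        powr_add[of "complex_of_real \<bar>x\<bar>" "- s - \<mu>" "\<mu> - 1"] by simp
    ultimately show ?thesis
      using u by (simp add: fractional_kernel_mult fractional_kernel_def[of _ "u - 1"]
          of_real_mult_powr del: of_real_mult of_real_diff)
  qed
  from has_lebesgue_integral_on_eq[OF this scaled_J]
  have "has_lebesgue_integral_on (\<lambda>u. of_real \<bar>x\<bar> * ?f (0 + x * u))
      (of_real \<bar>x\<bar> powr (- s) * (J / Gamma \<mu>)) {1<..}"
    by simp
  moreover have "{u. 0 + x * u \<in> {y. y / x > 1}} = {1<..}"
    using x by auto
  ultimately show ?thesis
    using has_lebesgue_integral_on_affine[OF x, of ?f 0 _ "{y. y / x > 1}"] by simp
qed

lemma Beta_divide_Gamma:
  assumes "Re \<mu> > 0"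
  shows "Beta s \<mu> * h / Gamma \<mu> = Gamma s / Gamma (s + \<mu>) * h"
  using Gamma_nonzero[OF Re_pos_not_nonpos_Int[OF assms]] by (simp add: Beta_def)

lemma Riemann_Liouville_hyp2F1_denominator:
  assumes x: "x \<noteq> 0" "x < 1" and c: "Re c > 0" and \<mu>: "Re \<mu> > 0"
  shows "has_lebesgue_integral_on
    (\<lambda>y. of_real \<bar>y\<bar> powr (c - 1) * hyp2F1 a b c (of_real y) * fractional_kernel \<mu> \<bar>x - y\<bar>)
    (of_real \<bar>x\<bar> powr (c + \<mu> - 1) * (Gamma c / Gamma (c + \<mu>) * hyp2F1 a b (c + \<mu>) (of_real x)))
    {y. 0 < y / x \<and> y / x < 1}"
  unfolding Beta_divide_Gamma[OF \<mu>, symmetric]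
  using Bateman_integral_denominator[OF c \<mu>, of "of_real x" a b] x
  by (intro Riemann_Liouville_beta_kernel) (simp_all add: of_real_in_slit_plane_iff mult.commute)

lemma Riemann_Liouville_hyp2F1_numerator:
  assumes x: "x \<noteq> 0" "x < 1" and c: "c \<notin> \<int>\<^sub>\<le>\<^sub>0" and s: "Re s > 0" and \<mu>: "Re \<mu> > 0"
  shows "has_lebesgue_integral_on
    (\<lambda>y. of_real \<bar>y\<bar> powr (s - 1) * hyp2F1 (s + \<mu>) b c (of_real y) * fractional_kernel \<mu> \<bar>x - y\<bar>)
    (of_real \<bar>x\<bar> powr (s + \<mu> - 1) * (Gamma s / Gamma (s + \<mu>) * hyp2F1 s b c (of_real x)))
    {y. 0 < y / x \<and> y / x < 1}"
  unfolding Beta_divide_Gamma[OF \<mu>, symmetric]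
  using Bateman_integral_numerator[OF s \<mu> c, of "of_real x" b] x
  by (intro Riemann_Liouville_beta_kernel) (simp_all add: of_real_in_slit_plane_iff mult.commute)

lemma Weyl_hyp2F1_inverse:
  assumes x: "x < 0 \<or> x > 1" and c: "c \<notin> \<int>\<^sub>\<le>\<^sub>0" and s: "Re s > 0" and \<mu>: "Re \<mu> > 0"
  shows "has_lebesgue_integral_on
    (\<lambda>y. of_real \<bar>y\<bar> powr (- s - \<mu>) * hyp2F1 (s + \<mu>) b c (of_real (inverse y)) *
      fractional_kernel \<mu> \<bar>x - y\<bar>)
    (of_real \<bar>x\<bar> powr (- s) * (Gamma s / Gamma (s + \<mu>) * hyp2F1 s b c (of_real (inverse x))))
    {y. y / x > 1}"
  unfolding Beta_divide_Gamma[OF \<mu>, symmetric]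
proof (rule Weyl_beta_kernel)
  have inverse_x: "inverse x < 1" and "x \<noteq> 0"
    using x by (auto simp: inverse_less_1_iff)
  have "inverse (x * u) < 1" if "u \<in> {1<..}" for u
  proof -
    have "x * u < 0 \<or> x * u > 1"
      using x that by (auto simp: mult_neg_pos less_1_mult)
    then show ?thesis
      by (auto simp: inverse_less_1_iff simp del: inverse_mult_distrib)
  qed
  then show "continuous_on {1<..} (\<lambda>u. hyp2F1 (s + \<mu>) b c (of_real (inverse (x * u))))"
    using x by (intro continuous_on_hyp2F1_of_real c continuous_intros) auto
  show "has_lebesgue_integral_on
      (\<lambda>t. beta_kernel s \<mu> t * hyp2F1 (s + \<mu>) b c (of_real (inverse (x * inverse t))))
      (Beta s \<mu> * hyp2F1 s b c (of_real (inverse x))) {0<..<1}"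
    using Bateman_integral_numerator[OF s \<mu> c, of "of_real (inverse x)" b] inverse_x
    by (simp add: of_real_in_slit_plane_iff[of "inverse x", simplified] mult.commute)
  show "x \<noteq> 0" by fact
qed

section \<open>The Weyl integral of the hypergeometric function\<close>

definition Gamma_quotient :: "complex \<Rightarrow> complex \<Rightarrow> complex" where
  "Gamma_quotient \<mu> z = Gamma (z - \<mu>) / Gamma z"

lemma Gamma_quotient_plus_1:
  assumes "z \<notin> \<int>\<^sub>\<le>\<^sub>0" "z - \<mu> \<notin> \<int>\<^sub>\<le>\<^sub>0"
  shows "Gamma_quotient \<mu> (z + 1) = (z - \<mu>) / z * Gamma_quotient \<mu> z"
  using Gamma_plus1[OF assms(1)] Gamma_plus1[OF assms(2)] by (simp add: Gamma_quotient_def diff_add_eq)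

lemma Gamma_quotient_plus_1_plus_1:
  "z \<notin> \<int>\<^sub>\<le>\<^sub>0 \<Longrightarrow> Gamma_quotient (\<mu> + 1) (z + 1) = Gamma_quotient \<mu> z / z"
  by (simp add: Gamma_quotient_def Gamma_plus1)

definition Weyl_factor :: "complex \<Rightarrow> complex \<Rightarrow> complex \<Rightarrow> complex \<Rightarrow> complex" where
  "Weyl_factor \<mu> \<alpha> \<beta> \<gamma> = Gamma_quotient \<mu> \<alpha> * Gamma_quotient \<mu> \<beta> / Gamma_quotient \<mu> \<gamma>"

lemma Weyl_factor_denominator_plus_1:
  assumes "\<gamma> \<notin> \<int>\<^sub>\<le>\<^sub>0" "\<gamma> - \<mu> \<notin> \<int>\<^sub>\<le>\<^sub>0"
  shows "Weyl_factor \<mu> \<alpha> \<beta> (\<gamma> + 1) = \<gamma> / (\<gamma> - \<mu>) * Weyl_factor \<mu> \<alpha> \<beta> \<gamma>"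
  by (simp add: Weyl_factor_def Gamma_quotient_plus_1[OF assms])

lemma Weyl_factor_numerators_plus_1:
  assumes "\<alpha> \<notin> \<int>\<^sub>\<le>\<^sub>0" "\<alpha> - \<mu> \<notin> \<int>\<^sub>\<le>\<^sub>0" "\<beta> \<notin> \<int>\<^sub>\<le>\<^sub>0" "\<beta> - \<mu> \<notin> \<int>\<^sub>\<le>\<^sub>0"
  shows "Weyl_factor \<mu> (\<alpha> + 1) (\<beta> + 1) \<gamma> = (\<alpha> - \<mu>) * (\<beta> - \<mu>) / (\<alpha> * \<beta>) * Weyl_factor \<mu> \<alpha> \<beta> \<gamma>"
  by (simp add: Weyl_factor_def Gamma_quotient_plus_1 assms)

lemma Weyl_factor_all_plus_1:
  assumes "\<alpha> \<notin> \<int>\<^sub>\<le>\<^sub>0" "\<beta> \<notin> \<int>\<^sub>\<le>\<^sub>0" "\<gamma> \<notin> \<int>\<^sub>\<le>\<^sub>0"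
  shows "Weyl_factor (\<mu> + 1) (\<alpha> + 1) (\<beta> + 1) (\<gamma> + 1) = \<gamma> / (\<alpha> * \<beta>) * Weyl_factor \<mu> \<alpha> \<beta> \<gamma>"
  by (simp add: Weyl_factor_def Gamma_quotient_plus_1_plus_1 assms)

lemma Weyl_integral_powr:
  assumes \<mu>: "Re \<mu> > 0" "Re \<alpha> > Re \<mu>" and t: "t > 0" and tx: "t * x < 1"
  shows "has_lebesgue_integral_on (\<lambda>y. of_real (1 - t * y) powr (- \<alpha>) * fractional_kernel \<mu> (x - y))
    (Gamma_quotient \<mu> \<alpha> * (of_real t powr (- \<mu>) * of_real (1 - t * x) powr (\<mu> - \<alpha>))) {..<x}"
proof -
  define r where "r = (1 - t * x) * inverse t"
  have r: "r > 0" using t tx by (simp add: r_def)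
  let ?f = "\<lambda>y. of_real (1 - t * y) powr (- \<alpha>) * fractional_kernel \<mu> (x - y)"
  let ?k = "of_real t powr (- \<mu>) * of_real (1 - t * x) powr (\<mu> - \<alpha>) / Gamma \<mu>"
  have "?k * (of_real (1 + u) powr (- \<alpha>) * of_real u powr (\<mu> - 1)) = of_real \<bar>- r\<bar> * ?f (x + - r * u)"
    if u: "u \<in> {0<..}" for u
  proof -
    have factor: "1 - t * (x + - r * u) = (1 - t * x) * (1 + u)" "x - (x + - r * u) = r * u"
      using t by (simp_all add: r_def field_simps)
    have "of_real \<bar>- r\<bar> * ?f (x + - r * u) = (of_real r * of_real r powr (\<mu> - 1)) *
        of_real (1 - t * x) powr (- \<alpha>) * (of_real (1 + u) powr (- \<alpha>) * fractional_kernel \<mu> u)"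
      using u r tx unfolding factor
      by (simp add: of_real_mult_powr fractional_kernel_mult del: of_real_mult of_real_add of_real_diff)
    also have "of_real r * of_real r powr (\<mu> - 1) = of_real t powr (- \<mu>) * of_real (1 - t * x) powr \<mu>"
      using r t tx of_real_powr_plus_1[of r "\<mu> - 1"]
      by (simp add: r_def of_real_mult_powr of_real_inverse_powr mult.commute
          del: of_real_mult of_real_inverse of_real_diff)
    also have "\<dots> * of_real (1 - t * x) powr (- \<alpha>) = ?k * Gamma \<mu>"
      using Gamma_nonzero[OF Re_pos_not_nonpos_Int[OF \<mu>(1)]] by (simp add: mult.assoc flip: powr_add)
    finally show ?thesis
      using Gamma_nonzero[OF Re_pos_not_nonpos_Int[OF \<mu>(1)]] by (simp add: fractional_kernel_def)
  qed
  from has_lebesgue_integral_on_eq[OF this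
      has_lebesgue_integral_on_mult_right[OF has_lebesgue_integral_on_Beta_half_line[OF \<mu>]]]
  have "has_lebesgue_integral_on (\<lambda>u. of_real \<bar>- r\<bar> * ?f (x + - r * u)) (?k * Beta \<mu> (\<alpha> - \<mu>)) {0<..}"
    by simp
  moreover have "{u. x + - r * u \<in> {..<x}} = {0<..}"
    using r by (auto simp: zero_less_mult_iff)
  moreover have "?k * Beta \<mu> (\<alpha> - \<mu>) =
      Gamma_quotient \<mu> \<alpha> * (of_real t powr (- \<mu>) * of_real (1 - t * x) powr (\<mu> - \<alpha>))"
    using Gamma_nonzero[OF Re_pos_not_nonpos_Int[OF \<mu>(1)]] by (simp add: Beta_def Gamma_quotient_def)
  ultimately show ?thesis
    using has_lebesgue_integral_on_affine[of "- r" ?f x _ "{..<x}"] r by simp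
qed

definition Euler_integrand :: "complex \<Rightarrow> complex \<Rightarrow> complex \<Rightarrow> real \<Rightarrow> real \<Rightarrow> complex" where
  "Euler_integrand \<alpha> \<beta> \<gamma> t y = beta_kernel \<beta> (\<gamma> - \<beta>) t * of_real (1 - t * y) powr (- \<alpha>)"

lemma one_minus_mult_pos:
  fixes t y :: real
  assumes "t \<in> {0<..<1}" "y < 1"
  shows "1 - t * y > 0"
proof (cases "y \<le> 0")
  case True
  then have "t * y \<le> 0" using assms(1) by (simp add: mult_nonneg_nonpos)
  then show ?thesis by simp
next
  case False
  then show ?thesis using mult_strict_mono[of t 1 y 1] assms by simp
qed

lemma norm_Euler_integrand:
  assumes t: "t \<in> {0<..<1}" and y: "y < 1"
  shows "of_real (norm (Euler_integrand \<alpha> \<beta> \<gamma> t y)) =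
    Euler_integrand (of_real (Re \<alpha>)) (of_real (Re \<beta>)) (of_real (Re \<gamma>)) t y"
proof -
  have "0 < t" "0 < 1 - t" using t by simp_all
  then show ?thesis
    using one_minus_mult_pos[OF t y]
    by (simp only: Euler_integrand_def beta_kernel_def norm_mult of_real_mult
        of_real_norm_of_real_powr) simp
qed

lemma has_lebesgue_integral_on_Euler_integrand:
  assumes "Re \<beta> > 0" "Re \<gamma> > Re \<beta>" "y < 1"
  shows "has_lebesgue_integral_on (\<lambda>t. Euler_integrand \<alpha> \<beta> \<gamma> t y)
    (Beta \<beta> (\<gamma> - \<beta>) * hyp2F1 \<alpha> \<beta> \<gamma> (of_real y)) {0<..<1}"
  using Euler_integral[OF assms(1,2), of "of_real y" \<alpha>] assms(3)
  by (simp add: Euler_integrand_def of_real_in_slit_plane_iff)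

lemma Weyl_integral_Euler_integrand:
  assumes \<mu>: "Re \<mu> > 0" "Re \<alpha> > Re \<mu>" and t: "t \<in> {0<..<1}" and x: "x < 1"
  shows "has_lebesgue_integral_on (\<lambda>y. Euler_integrand \<alpha> \<beta> \<gamma> t y * fractional_kernel \<mu> (x - y))
    (Gamma_quotient \<mu> \<alpha> * Euler_integrand (\<alpha> - \<mu>) (\<beta> - \<mu>) (\<gamma> - \<mu>) t x) {..<x}"
proof -
  have "has_lebesgue_integral_on (\<lambda>y. beta_kernel \<beta> (\<gamma> - \<beta>) t *
      (of_real (1 - t * y) powr (- \<alpha>) * fractional_kernel \<mu> (x - y)))
    (beta_kernel \<beta> (\<gamma> - \<beta>) t *
      (Gamma_quotient \<mu> \<alpha> * (of_real t powr (- \<mu>) * of_real (1 - t * x) powr (\<mu> - \<alpha>)))) {..<x}"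
    using \<mu> t one_minus_mult_pos[OF t x]
    by (intro has_lebesgue_integral_on_mult_right Weyl_integral_powr) auto
  moreover have "of_real t powr (\<beta> - \<mu> - 1) = complex_of_real t powr (\<beta> - 1) * of_real t powr (- \<mu>)"
    by (simp add: algebra_simps flip: powr_add)
  ultimately show ?thesis
    by (simp add: Euler_integrand_def beta_kernel_def mult_ac)
qed

lemma integrable_Euler_integrand_fractional_kernel:
  assumes \<mu>: "Re \<mu> > 0" and \<alpha>: "Re \<alpha> > Re \<mu>" and \<beta>: "Re \<beta> > Re \<mu>" and \<gamma>: "Re \<gamma> > Re \<beta>"
    and x: "x < 1"
  shows "integrable (lborel \<Otimes>\<^sub>M lborel) (\<lambda>p. indicator ({0<..<1} \<times> {..<x}) p *\<^sub>R
    (case p of (t, y) \<Rightarrow> Euler_integrand \<alpha> \<beta> \<gamma> t y * fractional_kernel \<mu> (x - y)))"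
proof (rule integrable_product_continuous)
  let ?\<mu> = "complex_of_real (Re \<mu>)" and ?\<alpha> = "complex_of_real (Re \<alpha>)"
    and ?\<beta> = "complex_of_real (Re \<beta>)" and ?\<gamma> = "complex_of_real (Re \<gamma>)"
  let ?k = "Gamma ?\<mu> / of_real (norm (Gamma \<mu>))"
  show "continuous_on ({0<..<1} \<times> {..<x})
      (\<lambda>(t, y). Euler_integrand \<alpha> \<beta> \<gamma> t y * fractional_kernel \<mu> (x - y))"
  proof -
    have "t * y < 1" if "t \<in> {0<..<1}" "y < x" for t y
      using one_minus_mult_pos[of t y] that x by simp
    then show ?thesis
      unfolding Euler_integrand_def beta_kernel_def case_prod_unfold
      by (intro continuous_on_mult continuous_on_of_real_powr continuous_on_fractional_kernel
          continuous_intros) auto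
  qed
  show "of_real (norm (Euler_integrand \<alpha> \<beta> \<gamma> t y * fractional_kernel \<mu> (x - y))) =
      ?k * (Euler_integrand ?\<alpha> ?\<beta> ?\<gamma> t y * fractional_kernel ?\<mu> (x - y))"
    if "t \<in> {0<..<1}" "y \<in> {..<x}" for t y
    using that x \<mu> by (simp add: norm_mult norm_Euler_integrand norm_fractional_kernel)
  show "set_integrable lborel {..<x} (\<lambda>y. Euler_integrand \<alpha> \<beta> \<gamma> t y * fractional_kernel \<mu> (x - y))"
    if "t \<in> {0<..<1}" for t
    using Weyl_integral_Euler_integrand[OF \<mu> \<alpha> that x] by (simp add: has_lebesgue_integral_on_def)
  show "has_lebesgue_integral_on
      (\<lambda>y. ?k * (Euler_integrand ?\<alpha> ?\<beta> ?\<gamma> t y * fractional_kernel ?\<mu> (x - y)))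
      (?k * (Gamma_quotient ?\<mu> ?\<alpha> * Euler_integrand (?\<alpha> - ?\<mu>) (?\<beta> - ?\<mu>) (?\<gamma> - ?\<mu>) t x)) {..<x}"
    if "t \<in> {0<..<1}" for t
    using that \<mu> \<alpha> x by (intro has_lebesgue_integral_on_mult_right Weyl_integral_Euler_integrand) auto
  have "has_lebesgue_integral_on
      (\<lambda>t. ?k * (Gamma_quotient ?\<mu> ?\<alpha> * Euler_integrand (?\<alpha> - ?\<mu>) (?\<beta> - ?\<mu>) (?\<gamma> - ?\<mu>) t x))
      (?k * (Gamma_quotient ?\<mu> ?\<alpha> * (Beta (?\<beta> - ?\<mu>) (?\<gamma> - ?\<mu> - (?\<beta> - ?\<mu>)) *
        hyp2F1 (?\<alpha> - ?\<mu>) (?\<beta> - ?\<mu>) (?\<gamma> - ?\<mu>) (of_real x)))) {0<..<1}"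
    using \<beta> \<gamma> x
    by (intro has_lebesgue_integral_on_mult_right has_lebesgue_integral_on_Euler_integrand) auto
  then show "set_integrable lborel {0<..<1}
      (\<lambda>t. ?k * (Gamma_quotient ?\<mu> ?\<alpha> * Euler_integrand (?\<alpha> - ?\<mu>) (?\<beta> - ?\<mu>) (?\<gamma> - ?\<mu>) t x))"
    by (simp only: has_lebesgue_integral_on_def)
qed simp_all

definition Weyl_formula :: "complex \<Rightarrow> complex \<Rightarrow> complex \<Rightarrow> complex \<Rightarrow> real \<Rightarrow> bool" where
  "Weyl_formula \<mu> \<alpha> \<beta> \<gamma> x \<longleftrightarrow>
     has_lebesgue_integral_on (\<lambda>y. hyp2F1 \<alpha> \<beta> \<gamma> (of_real y) * fractional_kernel \<mu> (x - y))
       (Weyl_factor \<mu> \<alpha> \<beta> \<gamma> * hyp2F1 (\<alpha> - \<mu>) (\<beta> - \<mu>) (\<gamma> - \<mu>) (of_real x)) {..<x}"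

text \<open>Insert the Euler integral and exchange the integrations: the Weyl integral of the Euler
  integrand is again an Euler integrand.\<close>
lemma Weyl_formula_Re_less:
  assumes \<mu>: "Re \<mu> > 0" and \<alpha>: "Re \<alpha> > Re \<mu>" and \<beta>: "Re \<beta> > Re \<mu>" and \<gamma>: "Re \<gamma> > Re \<beta>"
    and x: "x < 1"
  shows "Weyl_formula \<mu> \<alpha> \<beta> \<gamma> x"
proof -
  let ?B = "Beta \<beta> (\<gamma> - \<beta>)" and ?B' = "Beta (\<beta> - \<mu>) (\<gamma> - \<mu> - (\<beta> - \<mu>))"
  have "has_lebesgue_integral_on (\<lambda>y. fractional_kernel \<mu> (x - y) * (?B * hyp2F1 \<alpha> \<beta> \<gamma> (of_real y)))
      (Gamma_quotient \<mu> \<alpha> * (?B' * hyp2F1 (\<alpha> - \<mu>) (\<beta> - \<mu>) (\<gamma> - \<mu>) (of_real x))) {..<x}"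
  proof (rule has_lebesgue_integral_on_Fubini[OF integrable_Euler_integrand_fractional_kernel[OF assms]])
    show "has_lebesgue_integral_on (\<lambda>y. Euler_integrand \<alpha> \<beta> \<gamma> t y * fractional_kernel \<mu> (x - y))
        (Gamma_quotient \<mu> \<alpha> * Euler_integrand (\<alpha> - \<mu>) (\<beta> - \<mu>) (\<gamma> - \<mu>) t x) {..<x}"
      if "t \<in> {0<..<1}" for t
      using Weyl_integral_Euler_integrand[OF \<mu> \<alpha> that x] .
    show "has_lebesgue_integral_on (\<lambda>t. Euler_integrand \<alpha> \<beta> \<gamma> t y * fractional_kernel \<mu> (x - y))
        (fractional_kernel \<mu> (x - y) * (?B * hyp2F1 \<alpha> \<beta> \<gamma> (of_real y))) {0<..<1}"
      if "y \<in> {..<x}" for y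
      unfolding mult.commute[of _ "fractional_kernel \<mu> (x - y)"] using \<mu> \<beta> \<gamma> x that
      by (intro has_lebesgue_integral_on_mult_right has_lebesgue_integral_on_Euler_integrand) auto
    show "has_lebesgue_integral_on
        (\<lambda>t. Gamma_quotient \<mu> \<alpha> * Euler_integrand (\<alpha> - \<mu>) (\<beta> - \<mu>) (\<gamma> - \<mu>) t x)
        (Gamma_quotient \<mu> \<alpha> * (?B' * hyp2F1 (\<alpha> - \<mu>) (\<beta> - \<mu>) (\<gamma> - \<mu>) (of_real x))) {0<..<1}"
      using \<beta> \<gamma> x
      by (intro has_lebesgue_integral_on_mult_right has_lebesgue_integral_on_Euler_integrand) auto
  qed
  from has_lebesgue_integral_on_mult_right[OF this, of "inverse ?B"]
  have "has_lebesgue_integral_on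
      (\<lambda>y. inverse ?B * (fractional_kernel \<mu> (x - y) * (?B * hyp2F1 \<alpha> \<beta> \<gamma> (of_real y))))
      (inverse ?B * (Gamma_quotient \<mu> \<alpha> * (?B' * hyp2F1 (\<alpha> - \<mu>) (\<beta> - \<mu>) (\<gamma> - \<mu>) (of_real x)))) {..<x}" .
  moreover have "inverse ?B * (K * (?B * F)) = F * K" for K F
    using Beta_nonzero[of \<beta> "\<gamma> - \<beta>"] \<mu> \<beta> \<gamma> by simp
  moreover have "inverse ?B * (Gamma_quotient \<mu> \<alpha> * (?B' * F)) = Weyl_factor \<mu> \<alpha> \<beta> \<gamma> * F" for F
    using \<beta> \<gamma> Gamma_nonzero[OF Re_pos_not_nonpos_Int[of "\<gamma> - \<beta>"]]
    by (simp add: Beta_def Gamma_quotient_def Weyl_factor_def mult_ac)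
  ultimately show ?thesis
    by (simp only: Weyl_formula_def)
qed

lemma hyp2F1_mult_fractional_kernel_raise_denominator:
  assumes "Re \<mu> > 0" "\<gamma> \<notin> \<int>\<^sub>\<le>\<^sub>0" "y < x" "y < 1"
  shows "hyp2F1 \<alpha> \<beta> \<gamma> (of_real y) * fractional_kernel \<mu> (x - y) =
    hyp2F1 \<alpha> \<beta> (\<gamma> + 1) (of_real y) * fractional_kernel \<mu> (x - y) + \<alpha> * \<beta> / (\<gamma> * (\<gamma> + 1)) *
      (of_real x * (hyp2F1 (\<alpha> + 1) (\<beta> + 1) (\<gamma> + 2) (of_real y) * fractional_kernel \<mu> (x - y)) +
       (- \<mu>) * (hyp2F1 (\<alpha> + 1) (\<beta> + 1) (\<gamma> + 2) (of_real y) * fractional_kernel (\<mu> + 1) (x - y)))"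
proof -
  have y_mult: "of_real y * fractional_kernel \<mu> (x - y) =
      of_real x * fractional_kernel \<mu> (x - y) - \<mu> * fractional_kernel (\<mu> + 1) (x - y)"
    using mult_fractional_kernel[of \<mu> "x - y"] assms by (simp add: algebra_simps)
  have "d * of_real y * F * fractional_kernel \<mu> (x - y) =
      d * (of_real x * (F * fractional_kernel \<mu> (x - y)) +
        (- \<mu>) * (F * fractional_kernel (\<mu> + 1) (x - y)))"
    for d F
  proof -
    have "d * of_real y * F * fractional_kernel \<mu> (x - y) =
        d * F * (of_real y * fractional_kernel \<mu> (x - y))"
      by (simp only: mult_ac)
    then show ?thesis
      unfolding y_mult by (simp add: algebra_simps)
  qed
  moreover have "hyp2F1 \<alpha> \<beta> \<gamma> (of_real y) = hyp2F1 \<alpha> \<beta> (\<gamma> + 1) (of_real y) +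
      \<alpha> * \<beta> / (\<gamma> * (\<gamma> + 1)) * of_real y * hyp2F1 (\<alpha> + 1) (\<beta> + 1) (\<gamma> + 2) (of_real y)"
    using assms by (intro hyp2F1_raise_denominator) (simp_all add: of_real_in_slit_plane_iff)
  ultimately show ?thesis
    by (simp only: distrib_right)
qed

lemma
  assumes \<mu>: "Re \<mu> > 0" and \<alpha>: "Re \<alpha> > Re \<mu>" and \<beta>: "Re \<beta> > Re \<mu>"
    and \<gamma>: "\<gamma> \<notin> \<int>\<^sub>\<le>\<^sub>0" and \<gamma>\<mu>: "\<gamma> - \<mu> \<notin> \<int>\<^sub>\<le>\<^sub>0"
  shows Weyl_factor_plus_1_plus_2:
      "\<alpha> * \<beta> / (\<gamma> * (\<gamma> + 1)) * Weyl_factor \<mu> (\<alpha> + 1) (\<beta> + 1) (\<gamma> + 2) =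
        (\<alpha> - \<mu>) * (\<beta> - \<mu>) / ((\<gamma> - \<mu>) * (\<gamma> - \<mu> + 1)) * Weyl_factor \<mu> \<alpha> \<beta> \<gamma>"
    and Weyl_factor_contiguous:
      "Weyl_factor \<mu> \<alpha> \<beta> (\<gamma> + 1) -
        \<mu> * (\<alpha> * \<beta> / (\<gamma> * (\<gamma> + 1)) * Weyl_factor (\<mu> + 1) (\<alpha> + 1) (\<beta> + 1) (\<gamma> + 2)) =
        Weyl_factor \<mu> \<alpha> \<beta> \<gamma>"
proof -
  have nonpos: "\<alpha> \<notin> \<int>\<^sub>\<le>\<^sub>0" "\<alpha> - \<mu> \<notin> \<int>\<^sub>\<le>\<^sub>0" "\<beta> \<notin> \<int>\<^sub>\<le>\<^sub>0" "\<beta> - \<mu> \<notin> \<int>\<^sub>\<le>\<^sub>0"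
      "\<gamma> + 1 \<notin> \<int>\<^sub>\<le>\<^sub>0" "\<gamma> + 1 - \<mu> \<notin> \<int>\<^sub>\<le>\<^sub>0"
    using \<mu> \<alpha> \<beta> \<gamma> plus_1_not_nonpos_Int[OF \<gamma>\<mu>]
    by (simp_all add: Re_pos_not_nonpos_Int plus_1_not_nonpos_Int diff_add_eq)
  then have nonzero: "\<alpha> \<noteq> 0" "\<beta> \<noteq> 0" "\<gamma> \<noteq> 0" "\<gamma> + 1 \<noteq> 0" "\<gamma> - \<mu> \<noteq> 0" "\<gamma> - \<mu> + 1 \<noteq> 0"
    using \<gamma> \<gamma>\<mu> by (auto simp: diff_add_eq)
  note denominator = Weyl_factor_denominator_plus_1[OF \<gamma> \<gamma>\<mu>]
  show "\<alpha> * \<beta> / (\<gamma> * (\<gamma> + 1)) * Weyl_factor \<mu> (\<alpha> + 1) (\<beta> + 1) (\<gamma> + 2) =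
      (\<alpha> - \<mu>) * (\<beta> - \<mu>) / ((\<gamma> - \<mu>) * (\<gamma> - \<mu> + 1)) * Weyl_factor \<mu> \<alpha> \<beta> \<gamma>"
    using nonzero Weyl_factor_denominator_plus_1[OF nonpos(5,6), of \<alpha> \<beta>]
    by (simp add: Weyl_factor_numerators_plus_1[OF nonpos(1-4)] denominator add.assoc diff_add_eq
        mult_ac)
  have "\<alpha> * \<beta> / (\<gamma> * (\<gamma> + 1)) * Weyl_factor (\<mu> + 1) (\<alpha> + 1) (\<beta> + 1) (\<gamma> + 2) =
      Weyl_factor \<mu> \<alpha> \<beta> \<gamma> / (\<gamma> - \<mu>)"
    using nonzero Weyl_factor_all_plus_1[OF nonpos(1,3,5), of \<mu>] by (simp add: denominator add.assoc)
  then show "Weyl_factor \<mu> \<alpha> \<beta> (\<gamma> + 1) -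
      \<mu> * (\<alpha> * \<beta> / (\<gamma> * (\<gamma> + 1)) * Weyl_factor (\<mu> + 1) (\<alpha> + 1) (\<beta> + 1) (\<gamma> + 2)) =
      Weyl_factor \<mu> \<alpha> \<beta> \<gamma>"
    using nonzero(5) by (simp add: denominator flip: diff_divide_distrib left_diff_distrib)
qed

lemma Weyl_formula_raise_denominator:
  assumes \<mu>: "Re \<mu> > 0" and \<alpha>: "Re \<alpha> > Re \<mu>" and \<beta>: "Re \<beta> > Re \<mu>"
    and \<gamma>: "\<gamma> \<notin> \<int>\<^sub>\<le>\<^sub>0" and \<gamma>\<mu>: "\<gamma> - \<mu> \<notin> \<int>\<^sub>\<le>\<^sub>0" and x: "x < 1"
    and formulas: "Weyl_formula \<mu> \<alpha> \<beta> (\<gamma> + 1) x" "Weyl_formula \<mu> (\<alpha> + 1) (\<beta> + 1) (\<gamma> + 2) x"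
      "Weyl_formula (\<mu> + 1) (\<alpha> + 1) (\<beta> + 1) (\<gamma> + 2) x"
  shows "Weyl_formula \<mu> \<alpha> \<beta> \<gamma> x"
proof -
  let ?W = Weyl_factor and ?d = "\<alpha> * \<beta> / (\<gamma> * (\<gamma> + 1))"
  let ?F = "\<lambda>\<mu> \<alpha> \<beta> \<gamma>. hyp2F1 (\<alpha> - \<mu>) (\<beta> - \<mu>) (\<gamma> - \<mu>) (of_real x)"
  let ?F1 = "hyp2F1 (\<alpha> - \<mu>) (\<beta> - \<mu>) (\<gamma> - \<mu> + 1) (of_real x)"
  let ?F2 = "hyp2F1 (\<alpha> - \<mu> + 1) (\<beta> - \<mu> + 1) (\<gamma> - \<mu> + 2) (of_real x)"
  have "has_lebesgue_integral_on (\<lambda>y. hyp2F1 \<alpha> \<beta> \<gamma> (of_real y) * fractional_kernel \<mu> (x - y))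
      (?W \<mu> \<alpha> \<beta> (\<gamma> + 1) * ?F \<mu> \<alpha> \<beta> (\<gamma> + 1) +
       ?d * (of_real x * (?W \<mu> (\<alpha> + 1) (\<beta> + 1) (\<gamma> + 2) * ?F \<mu> (\<alpha> + 1) (\<beta> + 1) (\<gamma> + 2)) +
         (- \<mu>) * (?W (\<mu> + 1) (\<alpha> + 1) (\<beta> + 1) (\<gamma> + 2) * ?F (\<mu> + 1) (\<alpha> + 1) (\<beta> + 1) (\<gamma> + 2)))) {..<x}"
    using \<mu> \<gamma> x
    by (intro has_lebesgue_integral_on_eq[OF hyp2F1_mult_fractional_kernel_raise_denominator[symmetric]]
        has_lebesgue_integral_on_add has_lebesgue_integral_on_mult_right
        formulas[unfolded Weyl_formula_def]) auto
  also have "?W \<mu> \<alpha> \<beta> (\<gamma> + 1) * ?F \<mu> \<alpha> \<beta> (\<gamma> + 1) +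
       ?d * (of_real x * (?W \<mu> (\<alpha> + 1) (\<beta> + 1) (\<gamma> + 2) * ?F \<mu> (\<alpha> + 1) (\<beta> + 1) (\<gamma> + 2)) +
         (- \<mu>) * (?W (\<mu> + 1) (\<alpha> + 1) (\<beta> + 1) (\<gamma> + 2) * ?F (\<mu> + 1) (\<alpha> + 1) (\<beta> + 1) (\<gamma> + 2))) =
      (?W \<mu> \<alpha> \<beta> (\<gamma> + 1) - \<mu> * (?d * ?W (\<mu> + 1) (\<alpha> + 1) (\<beta> + 1) (\<gamma> + 2))) * ?F1 +
       (?d * ?W \<mu> (\<alpha> + 1) (\<beta> + 1) (\<gamma> + 2)) * of_real x * ?F2"
    by (simp add: algebra_simps)
  also have "\<dots> = ?W \<mu> \<alpha> \<beta> \<gamma> * (?F1 +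
       (\<alpha> - \<mu>) * (\<beta> - \<mu>) / ((\<gamma> - \<mu>) * (\<gamma> - \<mu> + 1)) * of_real x * ?F2)"
    unfolding Weyl_factor_contiguous[OF \<mu> \<alpha> \<beta> \<gamma> \<gamma>\<mu>] Weyl_factor_plus_1_plus_2[OF \<mu> \<alpha> \<beta> \<gamma> \<gamma>\<mu>]
    by (simp add: algebra_simps)
  also have "?F1 + (\<alpha> - \<mu>) * (\<beta> - \<mu>) / ((\<gamma> - \<mu>) * (\<gamma> - \<mu> + 1)) * of_real x * ?F2 = ?F \<mu> \<alpha> \<beta> \<gamma>"
    using x \<gamma>\<mu> by (intro hyp2F1_raise_denominator[symmetric]) (simp_all add: of_real_in_slit_plane_iff)
  finally show ?thesis
    by (simp only: Weyl_formula_def)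
qed

lemma Weyl_integral_hyp2F1:
  assumes "Re \<mu> > 0" "Re \<alpha> > Re \<mu>" "Re \<beta> > Re \<mu>" "\<gamma> \<notin> \<int>\<^sub>\<le>\<^sub>0" "\<gamma> - \<mu> \<notin> \<int>\<^sub>\<le>\<^sub>0" and x: "x < 1"
  shows "Weyl_formula \<mu> \<alpha> \<beta> \<gamma> x"
proof -
  obtain n where "real n > Re \<beta> - Re \<gamma>"
    using reals_Archimedean2 by blast
  then have "Re \<gamma> + real n > Re \<beta>" by simp
  then show ?thesis
    using assms(1-5)
  proof (induction n arbitrary: \<mu> \<alpha> \<beta> \<gamma>)
    case 0
    then show ?case using x by (intro Weyl_formula_Re_less) auto
  next
    case (Suc n)
    have shift: "\<gamma> + 1 - \<mu> = \<gamma> - \<mu> + 1" "\<gamma> + 2 - \<mu> = \<gamma> - \<mu> + 2" "\<gamma> + 2 - (\<mu> + 1) = \<gamma> - \<mu> + 1"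
      by simp_all
    show ?case
      by (rule Weyl_formula_raise_denominator; (rule Suc.IH)?)
         (use Suc.prems x in \<open>simp_all add: shift plus_1_not_nonpos_Int plus_2_not_nonpos_Int\<close>)
  qed
qed

section \<open>Fractional integrals of the solutions\<close>

lemma powr_mult_powr: "(x :: complex) powr p * (x powr q * r) = x powr (p + q) * r"
  by (simp add: powr_add)

lemma powr_mult_w2:
  assumes "y \<noteq> 0"
  shows "of_real \<bar>y\<bar> powr (c - 1) * w2 y a b c = hyp2F1 (a - c + 1) (b - c + 1) (2 - c) (of_real y)"
  unfolding w2_def powr_mult_powr using assms by simp

lemma powr_mult_w5:
  assumes "y > 0" "a + b - c + 1 \<notin> \<int>\<^sub>\<le>\<^sub>0"
  shows "of_real y powr (c - 1) * w5 y a b c =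
    hyp2F1 (b - c + 1) (a - c + 1) (a + b - c + 1) (of_real (1 - y))"
proof -
  have "w5 y a b c = of_real y powr (1 - c) *
      hyp2F1 (b - c + 1) (a - c + 1) (a + b - c + 1) (of_real (1 - y))"
    using hyp2F1_Euler_transformation[OF assms(2), of "of_real (1 - y)" a b] assms(1)
    by (simp add: w5_def of_real_in_slit_plane_iff[of "1 - y", simplified] algebra_simps)
  then show ?thesis
    using assms(1) powr_mult_powr[of "of_real y" "c - 1" "1 - c"] by simp
qed

lemma powr_mult_w6:
  assumes "y > 0" "c - a - b + 1 \<notin> \<int>\<^sub>\<le>\<^sub>0"
  shows "of_real y powr (c - 1) * w6 y a b c =
    of_real \<bar>1 - y\<bar> powr (c - a - b) * hyp2F1 (1 - a) (1 - b) (c - a - b + 1) (of_real (1 - y))"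
proof -
  have "hyp2F1 (c - a) (c - b) (c - a - b + 1) (of_real (1 - y)) =
      of_real y powr (1 - c) * hyp2F1 (1 - b) (1 - a) (c - a - b + 1) (of_real (1 - y))"
    using hyp2F1_Euler_transformation[OF assms(2), of "of_real (1 - y)" "c - a" "c - b"] assms(1)
    by (simp add: of_real_in_slit_plane_iff[of "1 - y", simplified] algebra_simps)
  then show ?thesis
    using assms(1) powr_mult_powr[of "of_real y" "c - 1" "1 - c"]
    by (simp add: w6_def mult.left_commute hyp2F1_commute[of "1 - b"])
qed

lemma Riemann_Liouville_powr_w1:
  assumes "Re \<mu> > 0" "x \<in> {..<0} \<union> {0<..<1}" "Re c > 0"
  shows "has_lebesgue_integral_on
    (\<lambda>y. of_real \<bar>y\<bar> powr (c - 1) * w1 y a b c * fractional_kernel \<mu> \<bar>x - y\<bar>)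
    (Gamma c / Gamma (c + \<mu>) * of_real \<bar>x\<bar> powr (c + \<mu> - 1) * w1 x a b (c + \<mu>))
    {y. 0 < y / x \<and> y / x < 1}"
  using Riemann_Liouville_hyp2F1_denominator[of x c \<mu> a b] assms by (auto simp: w1_def mult_ac)

lemma Weyl_powr_w2:
  assumes "Re \<mu> > 0" "x \<in> {..<0} \<union> {0<..<1}" "Re (a - c + 1) > Re \<mu>" "Re (b - c + 1) > Re \<mu>"
    "2 - c \<notin> \<int>\<^sub>\<le>\<^sub>0" "2 - (c + \<mu>) \<notin> \<int>\<^sub>\<le>\<^sub>0"
  shows "has_lebesgue_integral_on
    (\<lambda>y. of_real \<bar>y\<bar> powr (c - 1) * w2 y a b c * fractional_kernel \<mu> (x - y))
    (Gamma (a - c - \<mu> + 1) / Gamma (a - c + 1) * (Gamma (b - c - \<mu> + 1) / Gamma (b - c + 1)) *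
     (Gamma (2 - c) / Gamma (2 - c - \<mu>)) * of_real \<bar>x\<bar> powr (c + \<mu> - 1) * w2 x a b (c + \<mu>)) {..<x}"
proof -
  have "Weyl_formula \<mu> (a - c + 1) (b - c + 1) (2 - c) x"
    using assms by (intro Weyl_integral_hyp2F1) (auto simp: algebra_simps)
  moreover have "of_real \<bar>x\<bar> powr (c + \<mu> - 1) * w2 x a b (c + \<mu>) =
      hyp2F1 (a - c - \<mu> + 1) (b - c - \<mu> + 1) (2 - c - \<mu>) (of_real x)"
    using powr_mult_w2[of x "c + \<mu>" a b] assms(2) by (auto simp: diff_diff_eq)
  ultimately have "has_lebesgue_integral_on
      (\<lambda>y. hyp2F1 (a - c + 1) (b - c + 1) (2 - c) (of_real y) * fractional_kernel \<mu> (x - y))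
      (Gamma (a - c - \<mu> + 1) / Gamma (a - c + 1) * (Gamma (b - c - \<mu> + 1) / Gamma (b - c + 1)) *
       (Gamma (2 - c) / Gamma (2 - c - \<mu>)) * (of_real \<bar>x\<bar> powr (c + \<mu> - 1) * w2 x a b (c + \<mu>))) {..<x}"
    by (simp only:) (simp add: Weyl_formula_def Weyl_factor_def Gamma_quotient_def diff_add_eq)
  \<comment> \<open>The factor \<open>\<bar>y\<bar>\<^sup>c\<^sup>-\<^sup>1\<close> cancels except at \<open>y = 0\<close>, where \<open>0 powr z = 0\<close>.\<close>
  then show ?thesis
    using has_lebesgue_integral_on_spike[of "{0}" "{..<x}"
        "\<lambda>y. of_real \<bar>y\<bar> powr (c - 1) * w2 y a b c * fractional_kernel \<mu> (x - y)"]
    by (simp add: powr_mult_w2 mult.assoc)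
qed

lemma Riemann_Liouville_powr_w2:
  assumes "Re \<mu> > 0" "x \<in> {..<0} \<union> {0<..<1}" "Re (a - c + 1) > Re \<mu>" "2 - c \<notin> \<int>\<^sub>\<le>\<^sub>0"
  shows "has_lebesgue_integral_on
    (\<lambda>y. of_real \<bar>y\<bar> powr (a - \<mu> - 1) * w2 y a b c * fractional_kernel \<mu> \<bar>x - y\<bar>)
    (Gamma (a - c - \<mu> + 1) / Gamma (a - c + 1) * of_real \<bar>x\<bar> powr (a - 1) * w2 x (a - \<mu>) b c)
    {y. 0 < y / x \<and> y / x < 1}"
proof -
  define s where "s = a - c - \<mu> + 1"
  have exponents: "s + \<mu> = a - c + 1" "a - \<mu> - 1 + (1 - c) = s - 1" "a - 1 + (1 - c) = a - c + 1 - 1"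
      "a - \<mu> - c + 1 = s"
    by (simp_all add: s_def)
  have "has_lebesgue_integral_on
      (\<lambda>y. of_real \<bar>y\<bar> powr (s - 1) * hyp2F1 (s + \<mu>) (b - c + 1) (2 - c) (of_real y) *
        fractional_kernel \<mu> \<bar>x - y\<bar>)
      (of_real \<bar>x\<bar> powr (s + \<mu> - 1) *
        (Gamma s / Gamma (s + \<mu>) * hyp2F1 s (b - c + 1) (2 - c) (of_real x)))
      {y. 0 < y / x \<and> y / x < 1}"
    using assms by (intro Riemann_Liouville_hyp2F1_numerator) (auto simp: s_def)
  then show ?thesis
    unfolding w2_def mult.assoc[of _ "of_real \<bar>x\<bar> powr (a - 1)"] powr_mult_powr s_def[symmetric]
    by (simp only: exponents mult_ac)
qed

lemma Weyl_powr_w3: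
  assumes "Re \<mu> > 0" "x \<in> {..<0} \<union> {1<..}" "Re (a - c + 1) > Re \<mu>" "a - b + 1 \<notin> \<int>\<^sub>\<le>\<^sub>0"
  shows "has_lebesgue_integral_on
    (\<lambda>y. of_real \<bar>y\<bar> powr (c - 1) * w3 y a b c * fractional_kernel \<mu> \<bar>x - y\<bar>)
    (Gamma (a - c - \<mu> + 1) / Gamma (a - c + 1) * of_real \<bar>x\<bar> powr (c + \<mu> - 1) * w3 x a b (c + \<mu>))
    {y. y / x > 1}"
proof -
  define s where "s = a - c - \<mu> + 1"
  have exponents: "s + \<mu> = a - c + 1" "- s - \<mu> = c - 1 + - a" "c + \<mu> - 1 + - a = - s" "a - (c + \<mu>) + 1 = s"
    by (simp_all add: s_def)
  have "has_lebesgue_integral_on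
      (\<lambda>y. of_real \<bar>y\<bar> powr (- s - \<mu>) * hyp2F1 (s + \<mu>) a (a - b + 1) (of_real (inverse y)) *
        fractional_kernel \<mu> \<bar>x - y\<bar>)
      (of_real \<bar>x\<bar> powr (- s) *
        (Gamma s / Gamma (s + \<mu>) * hyp2F1 s a (a - b + 1) (of_real (inverse x))))
      {y. y / x > 1}"
    using assms by (intro Weyl_hyp2F1_inverse) (auto simp: s_def)
  then show ?thesis
    unfolding w3_def mult.assoc[of _ "of_real \<bar>x\<bar> powr (c + \<mu> - 1)"] powr_mult_powr
      s_def[symmetric] hyp2F1_commute[of a]
    by (simp only: exponents mult_ac)
qed

lemma Weyl_powr_w4:
  assumes "Re \<mu> > 0" "x \<in> {..<0} \<union> {1<..}" "Re (b - c + 1) > Re \<mu>" "b - a + 1 \<notin> \<int>\<^sub>\<le>\<^sub>0"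
  shows "has_lebesgue_integral_on
    (\<lambda>y. of_real \<bar>y\<bar> powr (c - 1) * w4 y a b c * fractional_kernel \<mu> \<bar>x - y\<bar>)
    (Gamma (b - c - \<mu> + 1) / Gamma (b - c + 1) * of_real \<bar>x\<bar> powr (c + \<mu> - 1) * w4 x a b (c + \<mu>))
    {y. y / x > 1}"
  using Weyl_powr_w3[OF assms] by (simp only: w3_def w4_def)

lemma Weyl_w4:
  assumes "Re \<mu> > 0" "x \<in> {..<0} \<union> {1<..}" "Re b > Re \<mu>" "b - a + 1 \<notin> \<int>\<^sub>\<le>\<^sub>0"
  shows "has_lebesgue_integral_on (\<lambda>y. w4 y a b c * fractional_kernel \<mu> \<bar>x - y\<bar>)
    (Gamma (b - \<mu>) / Gamma b * w4 x (a - \<mu>) (b - \<mu>) (c - \<mu>)) {y. y / x > 1}"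
  using Weyl_hyp2F1_inverse[of x "b - a + 1" "b - \<mu>" \<mu> "b - c + 1"] assms
  by (auto simp: w4_def mult_ac)

lemma Weyl_powr_w5:
  assumes "Re \<mu> > 0" "x > 0" "Re (a - c + 1) > Re \<mu>" "Re (b - c + 1) > Re \<mu>"
    "a + b - c + 1 \<notin> \<int>\<^sub>\<le>\<^sub>0" "a + b - (c + \<mu>) + 1 \<notin> \<int>\<^sub>\<le>\<^sub>0"
  shows "has_lebesgue_integral_on
    (\<lambda>y. of_real y powr (c - 1) * w5 y a b c * fractional_kernel \<mu> (y - x))
    (Gamma (b - c - \<mu> + 1) / Gamma (b - c + 1) * (Gamma (a - c - \<mu> + 1) / Gamma (a - c + 1)) *
     (Gamma (a + b - c + 1) / Gamma (a + b - c - \<mu> + 1)) *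
     of_real x powr (c + \<mu> - 1) * w5 x a b (c + \<mu>)) {x<..}"
proof -
  have "Weyl_formula \<mu> (b - c + 1) (a - c + 1) (a + b - c + 1) (1 - x)"
    using assms by (intro Weyl_integral_hyp2F1) (auto simp: algebra_simps)
  then have "has_lebesgue_integral_on
      (\<lambda>y. hyp2F1 (b - c + 1) (a - c + 1) (a + b - c + 1) (of_real (1 - y)) *
        fractional_kernel \<mu> (1 - x - (1 - y)))
      (Gamma (b - c - \<mu> + 1) / Gamma (b - c + 1) * (Gamma (a - c - \<mu> + 1) / Gamma (a - c + 1)) *
       (Gamma (a + b - c + 1) / Gamma (a + b - c - \<mu> + 1)) *
       (of_real x powr (c + \<mu> - 1) * w5 x a b (c + \<mu>))) {y. 1 - y \<in> {..<1 - x}}"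
    unfolding Weyl_formula_def powr_mult_w5[OF assms(2,6)]
    by (intro has_lebesgue_integral_on_reflect)
       (simp add: Weyl_factor_def Gamma_quotient_def algebra_simps)
  moreover have "{y. 1 - y \<in> {..<1 - x}} = {x<..}" by auto
  ultimately have "has_lebesgue_integral_on
      (\<lambda>y. hyp2F1 (b - c + 1) (a - c + 1) (a + b - c + 1) (of_real (1 - y)) *
        fractional_kernel \<mu> (y - x))
      (Gamma (b - c - \<mu> + 1) / Gamma (b - c + 1) * (Gamma (a - c - \<mu> + 1) / Gamma (a - c + 1)) *
       (Gamma (a + b - c + 1) / Gamma (a + b - c - \<mu> + 1)) *
       of_real x powr (c + \<mu> - 1) * w5 x a b (c + \<mu>)) {x<..}"
    by (simp add: mult.assoc)
  then show ?thesis
    by (rule has_lebesgue_integral_on_eq[rotated]) (use assms(2,5) in \<open>simp add: powr_mult_w5\<close>)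
qed

lemma Riemann_Liouville_at_1_hyp2F1_denominator:
  assumes "x \<noteq> 1" "x > 0" "Re c > 0" "Re \<mu> > 0"
  shows "has_lebesgue_integral_on
    (\<lambda>y. of_real \<bar>1 - y\<bar> powr (c - 1) * hyp2F1 a b c (of_real (1 - y)) * fractional_kernel \<mu> \<bar>x - y\<bar>)
    (of_real \<bar>1 - x\<bar> powr (c + \<mu> - 1) *
      (Gamma c / Gamma (c + \<mu>) * hyp2F1 a b (c + \<mu>) (of_real (1 - x))))
    {y. 0 < (1 - y) / (1 - x) \<and> (1 - y) / (1 - x) < 1}"
  using has_lebesgue_integral_on_reflect[OF Riemann_Liouville_hyp2F1_denominator[of "1 - x" c \<mu> a b]]
    assms
  by (simp add: abs_minus_commute)

lemma Riemann_Liouville_w6: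
  assumes "Re \<mu> > 0" "x \<in> {0<..<1} \<union> {1<..}" "Re (c - a - b + 1) > 0"
  shows "has_lebesgue_integral_on (\<lambda>y. w6 y a b c * fractional_kernel \<mu> \<bar>x - y\<bar>)
    (Gamma (c - a - b + 1) / Gamma (c - a - b + \<mu> + 1) * w6 x (a - \<mu>) (b - \<mu>) (c - \<mu>))
    {y. 0 < (1 - y) / (1 - x) \<and> (1 - y) / (1 - x) < 1}"
  using Riemann_Liouville_at_1_hyp2F1_denominator[of x "c - a - b + 1" \<mu> "c - a" "c - b"] assms
  by (auto simp: w6_def algebra_simps)

lemma Riemann_Liouville_powr_w6:
  assumes "Re \<mu> > 0" "x \<in> {0<..<1} \<union> {1<..}" "Re (c - a - b + 1) > 0"
  shows "has_lebesgue_integral_on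
    (\<lambda>y. of_real y powr (c - 1) * w6 y a b c * fractional_kernel \<mu> \<bar>y - x\<bar>)
    (Gamma (c - a - b + 1) / Gamma (c - a - b + \<mu> + 1) * of_real x powr (c + \<mu> - 1) * w6 x a b (c + \<mu>))
    {y. 0 < (1 - y) / (1 - x) \<and> (1 - y) / (1 - x) < 1}"
proof (rule has_lebesgue_integral_on_eq)
  have params: "c - a - b + 1 \<notin> \<int>\<^sub>\<le>\<^sub>0" "c + \<mu> - a - b + 1 \<notin> \<int>\<^sub>\<le>\<^sub>0"
    using assms by (auto intro!: Re_pos_not_nonpos_Int)
  show "of_real \<bar>1 - y\<bar> powr (c - a - b) * hyp2F1 (1 - a) (1 - b) (c - a - b + 1) (of_real (1 - y)) *
      fractional_kernel \<mu> \<bar>x - y\<bar> = of_real y powr (c - 1) * w6 y a b c * fractional_kernel \<mu> \<bar>y - x\<bar>"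
    if "y \<in> {y. 0 < (1 - y) / (1 - x) \<and> (1 - y) / (1 - x) < 1}" for y
  proof -
    have "y > 0"
      using that assms(2) by (cases "x < 1") (auto simp: zero_less_divide_iff divide_less_eq)
    then show ?thesis
      using params by (simp add: powr_mult_w6 abs_minus_commute)
  qed
  have w6_x: "of_real x powr (c + \<mu> - 1) * w6 x a b (c + \<mu>) = of_real \<bar>1 - x\<bar> powr (c + \<mu> - a - b) *
      hyp2F1 (1 - a) (1 - b) (c + \<mu> - a - b + 1) (of_real (1 - x))"
    using assms params by (intro powr_mult_w6) auto
  show "has_lebesgue_integral_on
      (\<lambda>y. of_real \<bar>1 - y\<bar> powr (c - a - b) * hyp2F1 (1 - a) (1 - b) (c - a - b + 1) (of_real (1 - y)) *
        fractional_kernel \<mu> \<bar>x - y\<bar>)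
      (Gamma (c - a - b + 1) / Gamma (c - a - b + \<mu> + 1) * of_real x powr (c + \<mu> - 1) * w6 x a b (c + \<mu>))
      {y. 0 < (1 - y) / (1 - x) \<and> (1 - y) / (1 - x) < 1}"
    using Riemann_Liouville_at_1_hyp2F1_denominator[of x "c - a - b + 1" \<mu> "1 - a" "1 - b"] assms
    unfolding mult.assoc[of _ "of_real x powr (c + \<mu> - 1)"] w6_x by (auto simp: algebra_simps)
qed

theorem mainTheorem8:
  fixes a b c \<mu> :: complex
  assumes "Re \<mu> > 0"
  shows
    "(\<forall>x\<in>{..<0} \<union> {0<..<1}. Re c > 0 \<and> c \<notin> \<int>\<^sub>\<le>\<^sub>0 \<and> c + \<mu> \<notin> \<int>\<^sub>\<le>\<^sub>0 \<longrightarrow>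
        has_lebesgue_integral_on
          (\<lambda>y. of_real \<bar>y\<bar> powr (c - 1) * w1 y a b c * (of_real \<bar>x - y\<bar> powr (\<mu> - 1) / Gamma \<mu>))
          (Gamma c / Gamma (c + \<mu>) * of_real \<bar>x\<bar> powr (c + \<mu> - 1) * w1 x a b (c + \<mu>))
          {y. 0 < y / x \<and> y / x < 1})
   \<and> (\<forall>x\<in>{..<0} \<union> {0<..<1}. Re (a - c + 1) > Re \<mu> \<and> Re (b - c + 1) > Re \<mu> \<and>
          2 - c \<notin> \<int>\<^sub>\<le>\<^sub>0 \<and> 2 - (c + \<mu>) \<notin> \<int>\<^sub>\<le>\<^sub>0 \<longrightarrow>
        has_lebesgue_integral_on
          (\<lambda>y. of_real \<bar>y\<bar> powr (c - 1) * w2 y a b c * (of_real (x - y) powr (\<mu> - 1) / Gamma \<mu>))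
          (Gamma (a - c - \<mu> + 1) / Gamma (a - c + 1) * (Gamma (b - c - \<mu> + 1) / Gamma (b - c + 1)) *
           (Gamma (2 - c) / Gamma (2 - c - \<mu>)) *
           of_real \<bar>x\<bar> powr (c + \<mu> - 1) * w2 x a b (c + \<mu>))
          {..<x})
   \<and> (\<forall>x\<in>{..<0} \<union> {1<..}. Re (a - c + 1) > Re \<mu> \<and> a - b + 1 \<notin> \<int>\<^sub>\<le>\<^sub>0 \<longrightarrow>
        has_lebesgue_integral_on
          (\<lambda>y. of_real \<bar>y\<bar> powr (c - 1) * w3 y a b c * (of_real \<bar>x - y\<bar> powr (\<mu> - 1) / Gamma \<mu>))
          (Gamma (a - c - \<mu> + 1) / Gamma (a - c + 1) *
           of_real \<bar>x\<bar> powr (c + \<mu> - 1) * w3 x a b (c + \<mu>))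
          {y. y / x > 1})
   \<and> (\<forall>x\<in>{..<0} \<union> {1<..}. Re (b - c + 1) > Re \<mu> \<and> b - a + 1 \<notin> \<int>\<^sub>\<le>\<^sub>0 \<longrightarrow>
        has_lebesgue_integral_on
          (\<lambda>y. of_real \<bar>y\<bar> powr (c - 1) * w4 y a b c * (of_real \<bar>x - y\<bar> powr (\<mu> - 1) / Gamma \<mu>))
          (Gamma (b - c - \<mu> + 1) / Gamma (b - c + 1) *
           of_real \<bar>x\<bar> powr (c + \<mu> - 1) * w4 x a b (c + \<mu>))
          {y. y / x > 1})
   \<and> (\<forall>x\<in>{0<..}. Re (a - c + 1) > Re \<mu> \<and> Re (b - c + 1) > Re \<mu> \<and>
          a + b - c + 1 \<notin> \<int>\<^sub>\<le>\<^sub>0 \<and> a + b - (c + \<mu>) + 1 \<notin> \<int>\<^sub>\<le>\<^sub>0 \<longrightarrow>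
        has_lebesgue_integral_on
          (\<lambda>y. of_real y powr (c - 1) * w5 y a b c * (of_real (y - x) powr (\<mu> - 1) / Gamma \<mu>))
          (Gamma (b - c - \<mu> + 1) / Gamma (b - c + 1) * (Gamma (a - c - \<mu> + 1) / Gamma (a - c + 1)) *
           (Gamma (a + b - c + 1) / Gamma (a + b - c - \<mu> + 1)) *
           of_real x powr (c + \<mu> - 1) * w5 x a b (c + \<mu>))
          {x<..})
   \<and> (\<forall>x\<in>{0<..<1} \<union> {1<..}. Re (c - a - b + 1) > 0 \<and>
          c - a - b + 1 \<notin> \<int>\<^sub>\<le>\<^sub>0 \<and> (c + \<mu>) - a - b + 1 \<notin> \<int>\<^sub>\<le>\<^sub>0 \<longrightarrow>
        has_lebesgue_integral_on
          (\<lambda>y. of_real y powr (c - 1) * w6 y a b c * (of_real \<bar>y - x\<bar> powr (\<mu> - 1) / Gamma \<mu>))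
          (Gamma (c - a - b + 1) / Gamma (c - a - b + \<mu> + 1) *
           of_real x powr (c + \<mu> - 1) * w6 x a b (c + \<mu>))
          {y. 0 < (1 - y) / (1 - x) \<and> (1 - y) / (1 - x) < 1})
   \<and> (\<forall>x\<in>{..<0} \<union> {0<..<1}. Re (a - c + 1) > Re \<mu> \<and> 2 - c \<notin> \<int>\<^sub>\<le>\<^sub>0 \<longrightarrow>
        has_lebesgue_integral_on
          (\<lambda>y. of_real \<bar>y\<bar> powr (a - \<mu> - 1) * w2 y a b c * (of_real \<bar>x - y\<bar> powr (\<mu> - 1) / Gamma \<mu>))
          (Gamma (a - c - \<mu> + 1) / Gamma (a - c + 1) *
           of_real \<bar>x\<bar> powr (a - 1) * w2 x (a - \<mu>) b c)
          {y. 0 < y / x \<and> y / x < 1})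
   \<and> (\<forall>x\<in>{..<0} \<union> {1<..}. Re b > Re \<mu> \<and>
          b - a + 1 \<notin> \<int>\<^sub>\<le>\<^sub>0 \<and> (b - \<mu>) - (a - \<mu>) + 1 \<notin> \<int>\<^sub>\<le>\<^sub>0 \<longrightarrow>
        has_lebesgue_integral_on
          (\<lambda>y. w4 y a b c * (of_real \<bar>x - y\<bar> powr (\<mu> - 1) / Gamma \<mu>))
          (Gamma (b - \<mu>) / Gamma b * w4 x (a - \<mu>) (b - \<mu>) (c - \<mu>))
          {y. y / x > 1})
   \<and> (\<forall>x\<in>{0<..<1} \<union> {1<..}. Re (c - a - b + 1) > 0 \<and>
          c - a - b + 1 \<notin> \<int>\<^sub>\<le>\<^sub>0 \<and> (c - \<mu>) - (a - \<mu>) - (b - \<mu>) + 1 \<notin> \<int>\<^sub>\<le>\<^sub>0 \<longrightarrow>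
        has_lebesgue_integral_on
          (\<lambda>y. w6 y a b c * (of_real \<bar>x - y\<bar> powr (\<mu> - 1) / Gamma \<mu>))
          (Gamma (c - a - b + 1) / Gamma (c - a - b + \<mu> + 1) * w6 x (a - \<mu>) (b - \<mu>) (c - \<mu>))
          {y. 0 < (1 - y) / (1 - x) \<and> (1 - y) / (1 - x) < 1})"
  unfolding fractional_kernel_def[symmetric]
  by (intro conjI ballI impI; elim conjE)
     (rule Riemann_Liouville_powr_w1 Weyl_powr_w2 Weyl_powr_w3 Weyl_powr_w4 Weyl_powr_w5
        Riemann_Liouville_powr_w6 Riemann_Liouville_powr_w2 Weyl_w4 Riemann_Liouville_w6;
      (rule assms | assumption | simp))+

end
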